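(* Let $k$ be any field and let $W=\sqrt{p/q}$ be a square root of a ratio of polynomials, i.e. $p,q\in k[X_1,\dots,X_n]$ with $q$ non-zero. Then the following statements hold. \begin{enumerate} \item There exists a squarefree polynomial $f\in k[X_1,\dots,X_n]$ such that $\sqrt{p/q}$ is rationalizable if and only if $\sqrt{f}$ is rationalizable. \item For $f$ squarefree and non-constant, let $\overline{V}$ be the hypersurface associated to $\sqrt f$ and $\overline{S}$ the double cover associated to $\sqrt f$ (two projective varieties over $k$, defined in the context). The following are equivalent: (a) $\sqrt{f}$ is rationalizable; (b) $\overline{V}$ is unirational over $k$; (c) $\overline{S}$ is unirational over $k$. \item Assume $k$ is algebraically closed, let $f$ be squarefree and non-constant, and let $d$ denote the degree of $f$. If $d\in\{1,2\}$, or if $\overline{V}$ has a singular point of multiplicity $d-1$, then $\sqrt{f}$ is rationalizable. \end{enumerate}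
   Context: Let $k$ be a field, $n\ge 1$, $R=k[X_1,\dots,X_n]$ and $Q=k(X_1,\dots,X_n)=\operatorname{Frac} R$. For $g\in Q$, the square root $\sqrt{g}$ (in a fixed algebraic closure of $Q$) is called rationalizable if there is a (unital) homomorphism of $k$-algebras $\phi\colon Q\to Q$ such that $\phi(g)$ is a square in $Q$. Let $f\in R$ be a non-constant squarefree polynomial of degree $d$. Associated hypersurface: let $V\subset\mathbb{A}^{n+1}_k$ (coordinates $X_1,\dots,X_n,W$) be the affine hypersurface $W^2=f$. The hypersurface $\overline{V}$ associated to $\sqrt f$ is the projective closure of $V$ in $\mathbb{P}^{n+1}_k$ with coordinates $z,x_1,\dots,x_n,w$, where $X_i=x_i/z$ and $W=w/z$. For $d\ge 2$ it is given by $z^{d-2}w^2-z^d f(x_1/z,\dots,x_n/z)=0$; for $d=1$ it is given by $w^2-z^2f(x_1/z,\dots,x_n/z)=0$. Associated double cover: put $r=\lceil d/2\rceil$ and let $\mathbb{P}_k(1,\dots,1,r)$ be the weighted projective space with coordinates $s,y_1,\dots,y_n,u$ of weights $1,1,\dots,1,r$. The double cover $\overline{S}$ associated to $\sqrt f$ is the hypersurface in it given by $u^2-s^{2r}f(y_1/s,\dots,y_n/s)=0$. A projective variety $Y$ over $k$ of dimension $N$ is unirational over $k$ if there is a dominant rational map $\mathbb{P}^N_k\dashrightarrow Y$ defined over $k$; equivalently, its function field embeds as a $k$-algebra into a purely transcendental extension of $k$ of transcendence degree $N$. *)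

theory Defs
  imports
    Complex_Main
    "HOL-Library.Poly_Mapping"
    "HOL-Computational_Algebra.Fraction_Field"
    "HOL-Computational_Algebra.Squarefree"
    "HOL-Algebra.Algebraic_Closure_Type"
    "HOL-Analysis.Function_Topology"
begin

section \<open>Polynomials in several variables\<close>

text \<open>
  A polynomial with variables indexed by \<open>'v\<close> and coefficients in \<open>'k\<close> is an element of the
  monoid algebra of the exponent vectors \<open>'v \<Rightarrow>\<^sub>0 nat\<close>.
\<close>

type_synonym ('v, 'k) mpoly = "('v \<Rightarrow>\<^sub>0 nat) \<Rightarrow>\<^sub>0 'k"

definition const :: "'k::zero \<Rightarrow> ('v, 'k) mpoly" where
  "const c = Poly_Mapping.single 0 c"

definition var :: "'v \<Rightarrow> ('v, 'k::zero_neq_one) mpoly" where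
  "var i = Poly_Mapping.single (Poly_Mapping.single i 1) 1"

text \<open>Evaluation at \<open>x\<close>, the coefficients being mapped by \<open>h\<close>.\<close>

definition eval_mpoly ::
  "('k::zero \<Rightarrow> 'r::comm_ring_1) \<Rightarrow> ('v::finite \<Rightarrow> 'r) \<Rightarrow> ('v, 'k) mpoly \<Rightarrow> 'r" where
  "eval_mpoly h x p =
    (\<Sum>m\<in>Poly_Mapping.keys p.
       h (Poly_Mapping.lookup p m) * (\<Prod>i\<in>UNIV. x i ^ Poly_Mapping.lookup m i))"

definition wdeg :: "('v::finite \<Rightarrow> nat) \<Rightarrow> ('v \<Rightarrow>\<^sub>0 nat) \<Rightarrow> nat" where
  "wdeg a m = (\<Sum>i\<in>UNIV. a i * Poly_Mapping.lookup m i)"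

abbreviation mdeg :: "('v::finite \<Rightarrow>\<^sub>0 nat) \<Rightarrow> nat" where
  "mdeg \<equiv> wdeg (\<lambda>_. 1)"

definition tdegree :: "('v::finite, 'k::zero) mpoly \<Rightarrow> nat" where
  "tdegree p = Max (insert 0 (mdeg ` Poly_Mapping.keys p))"

definition homogeneous :: "('v::finite \<Rightarrow> nat) \<Rightarrow> nat \<Rightarrow> ('v, 'k::zero) mpoly \<Rightarrow> bool" where
  "homogeneous a e p \<longleftrightarrow> (\<forall>m\<in>Poly_Mapping.keys p. wdeg a m = e)"

definition hom_component ::
  "('v::finite \<Rightarrow> nat) \<Rightarrow> nat \<Rightarrow> ('v, 'k::comm_monoid_add) mpoly \<Rightarrow> ('v, 'k) mpoly" where
  "hom_component a e p =
    (\<Sum>m\<in>{m \<in> Poly_Mapping.keys p. wdeg a m = e}.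
       Poly_Mapping.single m (Poly_Mapping.lookup p m))"

definition partial_deriv :: "'v \<Rightarrow> ('v, 'k::comm_ring_1) mpoly \<Rightarrow> ('v, 'k) mpoly" where
  "partial_deriv i p =
    (\<Sum>m\<in>Poly_Mapping.keys p.
       Poly_Mapping.single (m - Poly_Mapping.single i 1)
         (of_nat (Poly_Mapping.lookup m i) * Poly_Mapping.lookup p m))"


section \<open>Rationalizable square roots\<close>

text \<open>
  The order on the index type of the variables only serves to make the polynomial ring an
  instance of \<^class>\<open>idom\<close>, so that its fraction field is available.
\<close>

definition k_algebra_hom ::
  "(('n::linorder, 'k::field) mpoly fract \<Rightarrow> ('n, 'k) mpoly fract) \<Rightarrow> bool" where
  "k_algebra_hom \<phi> \<longleftrightarrow>
    \<phi> 1 = 1 \<and>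
    (\<forall>x y. \<phi> (x + y) = \<phi> x + \<phi> y) \<and>
    (\<forall>x y. \<phi> (x * y) = \<phi> x * \<phi> y) \<and>
    (\<forall>c. \<phi> (Fract (const c) 1) = Fract (const c) 1)"

text \<open>\<open>rationalizable g\<close> says that the square root of \<open>g\<close> is rationalizable.\<close>

definition rationalizable :: "('n::linorder, 'k::field) mpoly fract \<Rightarrow> bool" where
  "rationalizable g \<longleftrightarrow> (\<exists>\<phi>. k_algebra_hom \<phi> \<and> (\<exists>h. \<phi> g = h\<^sup>2))"


section \<open>Weighted projective spaces\<close>

text \<open>
  The points of the projective space with weights \<open>a\<close> are the points of the scheme Proj of the
  polynomial ring graded by \<open>a\<close>, so that no assumption on the base field is needed.
\<close>

definition Proj :: "('v::finite \<Rightarrow> nat) \<Rightarrow> ('v, 'k::field) mpoly set set" where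
  "Proj a = {P. primeideal P ring_of_type_algebra \<and>
                (\<forall>p\<in>P. \<forall>e. hom_component a e p \<in> P) \<and>
                (\<exists>i. var i \<notin> P)}"

definition zariski :: "('v::finite \<Rightarrow> nat) \<Rightarrow> ('v, 'k::field) mpoly set topology" where
  "zariski a = topology_generated_by {{P \<in> Proj a. g \<notin> P} | g. True}"

definition hypersurface ::
  "('v::finite \<Rightarrow> nat) \<Rightarrow> ('v, 'k::field) mpoly \<Rightarrow> ('v, 'k) mpoly set set" where
  "hypersurface a F = {P \<in> Proj a. F \<in> P}"

text \<open>
  A rational map from the projective space with homogeneous coordinates \<open>'u\<close> to the one with
  coordinates \<open>'v\<close> and weights \<open>a\<close> is given by forms \<open>\<Phi> i\<close> of degrees \<open>e * a i\<close>, not all zero.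
  It is defined where some \<open>\<Phi> i\<close> does not vanish, and maps \<open>P\<close> to the homogeneous ideal
  generated by the forms \<open>G\<close> with \<open>G(\<Phi>) \<in> P\<close>.  Each rational map whose image is not contained in
  the zero locus of all coordinates of weight 1 has this form: dehomogenize with
  respect to such a coordinate and clear denominators.
\<close>

definition rational_map ::
  "('v::finite \<Rightarrow> nat) \<Rightarrow> ('v \<Rightarrow> ('u::finite, 'k::field) mpoly) \<Rightarrow> bool" where
  "rational_map a \<Phi> \<longleftrightarrow>
    (\<exists>e. \<forall>i. homogeneous (\<lambda>_. 1) (e * a i) (\<Phi> i)) \<and> (\<exists>i. \<Phi> i \<noteq> 0)"

definition domain_of_map ::
  "('v::finite \<Rightarrow> ('u::finite, 'k::field) mpoly) \<Rightarrow> ('u, 'k) mpoly set set" where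
  "domain_of_map \<Phi> = {P \<in> Proj (\<lambda>_. 1). \<exists>i. \<Phi> i \<notin> P}"

definition image_point ::
  "('v::finite \<Rightarrow> nat) \<Rightarrow> ('v \<Rightarrow> ('u::finite, 'k::field) mpoly) \<Rightarrow>
   ('u, 'k) mpoly set \<Rightarrow> ('v, 'k) mpoly set" where
  "image_point a \<Phi> P = {G. \<forall>e. eval_mpoly const \<Phi> (hom_component a e G) \<in> P}"

text \<open>
  For the closed set \<open>Y\<close>, this says that the image lies in \<open>Y\<close> and is dense there.
\<close>

definition dominant_onto ::
  "('v::finite \<Rightarrow> nat) \<Rightarrow> ('v \<Rightarrow> ('u::finite, 'k::field) mpoly) \<Rightarrow> ('v, 'k) mpoly set set \<Rightarrow> bool"
  where
  "dominant_onto a \<Phi> Y \<longleftrightarrow>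
    zariski a closure_of (image_point a \<Phi> ` domain_of_map \<Phi>) = Y"

text \<open>
  Unirationality over \<open>'k\<close> of a hypersurface \<open>Y\<close> in the projective space with coordinates
  \<open>'u option\<close>: the dimension of \<open>Y\<close> is that of the projective space with coordinates \<open>'u\<close>.
\<close>

definition unirational :: "('u::finite option \<Rightarrow> nat) \<Rightarrow> ('u option, 'k::field) mpoly set set \<Rightarrow> bool"
  where
  "unirational a Y \<longleftrightarrow>
    (\<exists>\<Phi> :: 'u option \<Rightarrow> ('u, 'k) mpoly. rational_map a \<Phi> \<and> dominant_onto a \<Phi> Y)"


section \<open>The associated hypersurface and the associated double cover\<close>

text \<open>
  The ambient coordinates of both varieties are indexed by \<open>'n option option\<close>: \<^term>\<open>None\<close> stands
  for \<open>w\<close> (or \<open>u\<close>), \<^term>\<open>Some None\<close> for the homogenizing coordinate \<open>z\<close> (or \<open>s\<close>), and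
  \<^term>\<open>Some (Some i)\<close> for \<open>x\<^sub>i\<close> (or \<open>y\<^sub>i\<close>).

  For \<open>e \<ge> tdegree f\<close>, the polynomial \<open>homogenize e f\<close> is \<open>z\<^sup>e f(x\<^sub>1/z, \<dots>, x\<^sub>n/z)\<close>.
\<close>

definition homogenize ::
  "nat \<Rightarrow> ('n::finite, 'k::field) mpoly \<Rightarrow> ('n option option, 'k) mpoly" where
  "homogenize e f =
    (\<Sum>m\<in>Poly_Mapping.keys f.
       const (Poly_Mapping.lookup f m) * var (Some None) ^ (e - mdeg m) *
       (\<Prod>i\<in>UNIV. var (Some (Some i)) ^ Poly_Mapping.lookup m i))"

definition assoc_hypersurface_eq ::
  "('n::finite, 'k::field) mpoly \<Rightarrow> ('n option option, 'k) mpoly" where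
  "assoc_hypersurface_eq f =
    (if tdegree f = 1 then (var None)\<^sup>2 - homogenize 2 f
     else var (Some None) ^ (tdegree f - 2) * (var None)\<^sup>2 - homogenize (tdegree f) f)"

definition assoc_hypersurface ::
  "('n::finite, 'k::field) mpoly \<Rightarrow> ('n option option, 'k) mpoly set set" where
  "assoc_hypersurface f = hypersurface (\<lambda>_. 1) (assoc_hypersurface_eq f)"

definition half_degree :: "('n::finite, 'k::field) mpoly \<Rightarrow> nat" where
  "half_degree f = nat \<lceil>real (tdegree f) / 2\<rceil>"

definition cover_weights :: "('n::finite, 'k::field) mpoly \<Rightarrow> 'n option option \<Rightarrow> nat" where
  "cover_weights f i = (if i = None then half_degree f else 1)"

definition assoc_double_cover ::
  "('n::finite, 'k::field) mpoly \<Rightarrow> ('n option option, 'k) mpoly set set" where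
  "assoc_double_cover f =
    hypersurface (cover_weights f) ((var None)\<^sup>2 - homogenize (2 * half_degree f) f)"


section \<open>Singular points of projective hypersurfaces\<close>

text \<open>
  Here \<open>c\<close> is a vector of homogeneous coordinates in \<open>'k\<close>, so these notions
  see all closed points only over an algebraically closed field.
\<close>

definition singular_point :: "('v::finite, 'k::field) mpoly \<Rightarrow> ('v \<Rightarrow> 'k) \<Rightarrow> bool" where
  "singular_point F c \<longleftrightarrow>
    (\<exists>i. c i \<noteq> 0) \<and> eval_mpoly id c F = 0 \<and> (\<forall>i. eval_mpoly id c (partial_deriv i F) = 0)"

text \<open>
  The chart where the \<open>i\<close>-th coordinate does not vanish is identified with the affine
  hyperplane of vectors with \<open>i\<close>-th coordinate \<open>c i\<close>.  The multiplicity of the point is the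
  lowest degree of a term of the equation in the affine coordinates of this chart centred at \<open>c\<close>;
  it does not depend on \<open>i\<close>.
\<close>

definition local_equation ::
  "('v::finite, 'k::field) mpoly \<Rightarrow> ('v \<Rightarrow> 'k) \<Rightarrow> 'v \<Rightarrow> ('v, 'k) mpoly" where
  "local_equation F c i =
    eval_mpoly const (\<lambda>j. if j = i then const (c j) else const (c j) + var j) F"

definition has_point_multiplicity ::
  "('v::finite, 'k::field) mpoly \<Rightarrow> ('v \<Rightarrow> 'k) \<Rightarrow> nat \<Rightarrow> bool" where
  "has_point_multiplicity F c \<mu> \<longleftrightarrow>
    (\<exists>i. c i \<noteq> 0 \<and>
      (\<exists>m\<in>Poly_Mapping.keys (local_equation F c i). mdeg m = \<mu>) \<and>
      (\<forall>m\<in>Poly_Mapping.keys (local_equation F c i). \<mu> \<le> mdeg m))"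

end

theory Submission
  imports Defs "HOL-Library.Option_ord"
begin

text \<open>
  Write \<open>R = k[X]\<close> and \<open>Q = Frac R\<close>.  A homomorphism \<open>Q \<rightarrow> Q\<close> over \<open>k\<close> is a substitution
  \<open>X\<^sub>i \<mapsto> a\<^sub>i\<close> by algebraically independent elements (\<open>rationalizable_iff_substitution\<close>).  So
  \<open>\<surd>f\<close> is rationalizable iff \<open>f(a) = h\<^sup>2\<close> for some \<open>h\<close> and some algebraically independent
  \<open>a\<^sub>1, \<dots>, a\<^sub>n\<close> in \<open>Q\<close>.  Multiplying a radicand by a nonzero square does not change whether its
  root is rationalizable.  This gives the first part: \<open>p/q = pq/q\<^sup>2\<close>, and \<open>pq\<close> is a square times a
  squarefree polynomial if it is nonzero.

  Both varieties have an equation \<open>F = z\<^sup>j w\<^sup>2 - z\<^sup>D f(x/z)\<close> with \<open>D = j + 2r\<close> and \<open>w\<close> of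
  weight \<open>r\<close>, so the locale \<open>quadratic_hypersurface\<close> treats them together.  Homogenizing a
  solution \<open>h\<^sup>2 = f(a)\<close> over a common denominator gives forms \<open>\<Phi>\<close> with \<open>F(\<Phi>) = 0\<close>, hence a
  rational map into the hypersurface.  The generic point of projective space goes to the ideal of
  all \<open>G\<close> whose homogeneous components vanish at \<open>\<Phi>\<close>.  The map is dominant because this ideal is
  generated by \<open>F\<close> (\<open>equation_dvd\<close>): modulo \<open>F\<close> and up to a power of \<open>z\<close>, each \<open>G\<close>
  has the form \<open>A + B w\<close>, and a relation \<open>A(a) + B(a) h = 0\<close> with \<open>B \<noteq> 0\<close> would make
  \<open>f = (A/B)\<^sup>2\<close> a square in \<open>Q\<close>.  For squarefree nonconstant \<open>f\<close> this is impossible, as \<open>R\<close> is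
  integrally closed in \<open>Q\<close> (\<open>squarefree_ratio_of_squares\<close>).

  Conversely, let \<open>\<Phi>\<close> be forms that define a dominant rational map.  Fix a square root \<open>y\<close> of \<open>f\<close> in
  an algebraic closure of \<open>Q\<close>.  The forms that vanish at \<open>(y, 1, X)\<close> make up a point of the
  hypersurface, and by density each form that vanishes at \<open>\<Phi>\<close> lies in it.  Applied to
  \<open>z\<close> and to homogenized elements of \<open>R\<close>, this says that the coordinates \<open>\<Phi>\<^sub>x/\<Phi>\<^sub>z\<close> are defined
  and algebraically independent; and \<open>F(\<Phi>) = 0\<close> makes \<open>f\<close> a square at them.

  For the third part, let \<open>c\<close> be a point of multiplicity \<open>D - 1\<close>.  Then
  \<open>F(\<eta> + u c) = F\<^sub>0(\<eta>) + u F\<^sub>1(\<eta>)\<close> with \<open>F\<^sub>1 \<noteq> 0\<close>, so a general line through \<open>c\<close> meets the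
  hypersurface in one further point, at \<open>u = -F\<^sub>0/F\<^sub>1\<close>, and these points parametrize it
  (\<open>rationalizable_if_multiplicity\<close>).  If \<open>f\<close> has degree 1 or 2, then \<open>D = 2\<close> and a point of
  multiplicity 1 suffices.  One of the points at infinity in a coordinate direction will do, since
  otherwise \<open>f\<close> would consist of a constant and multiples of squares of variables, in
  characteristic 2, and so be a square (\<open>rationalizable_if_degree_le_2\<close>).
\<close>

section \<open>Ring homomorphisms\<close>

definition unital_hom :: "('a::comm_ring_1 \<Rightarrow> 'b::comm_ring_1) \<Rightarrow> bool" where
  "unital_hom h \<longleftrightarrow> h 1 = 1 \<and> (\<forall>x y. h (x + y) = h x + h y) \<and> (\<forall>x y. h (x * y) = h x * h y)"

lemma unital_hom_1: "unital_hom h \<Longrightarrow> h 1 = 1"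
  and unital_hom_add: "unital_hom h \<Longrightarrow> h (x + y) = h x + h y"
  and unital_hom_mult: "unital_hom h \<Longrightarrow> h (x * y) = h x * h y"
  by (auto simp: unital_hom_def)

lemma unital_hom_0: assumes "unital_hom h" shows "h 0 = 0"
  using unital_hom_add[OF assms, of 0 0] by simp

lemma unital_hom_uminus: assumes "unital_hom h" shows "h (- x) = - h x"
  using unital_hom_add[OF assms, of x "- x"] unital_hom_0[OF assms] by (simp add: eq_neg_iff_add_eq_0 add.commute)

lemma unital_hom_diff: assumes "unital_hom h" shows "h (x - y) = h x - h y"
  using unital_hom_add[OF assms, of x "- y"] unital_hom_uminus[OF assms, of y] by simp

lemma unital_hom_power: "unital_hom h \<Longrightarrow> h (x ^ n) = h x ^ n"
  by (induction n) (auto simp: unital_hom_1 unital_hom_mult)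

lemma unital_hom_sum: "unital_hom h \<Longrightarrow> h (sum g A) = (\<Sum>x\<in>A. h (g x))"
  by (induction A rule: infinite_finite_induct) (auto simp: unital_hom_0 unital_hom_add)

lemma unital_hom_prod: "unital_hom h \<Longrightarrow> h (prod g A) = (\<Prod>x\<in>A. h (g x))"
  by (induction A rule: infinite_finite_induct) (auto simp: unital_hom_1 unital_hom_mult)

lemmas unital_hom_simps = unital_hom_1 unital_hom_add unital_hom_mult unital_hom_0
  unital_hom_uminus unital_hom_diff unital_hom_power unital_hom_sum unital_hom_prod

lemma unital_hom_comp: "unital_hom g \<Longrightarrow> unital_hom h \<Longrightarrow> unital_hom (\<lambda>x. g (h x))"
  by (simp add: unital_hom_def)

lemma unital_hom_const: "unital_hom (const :: 'k::comm_ring_1 \<Rightarrow> ('v, 'k) mpoly)"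
  by (simp add: unital_hom_def const_def single_add mult_single)

lemma unital_hom_const_poly: "unital_hom h \<Longrightarrow> unital_hom (\<lambda>c. [:h c:])"
  by (simp add: unital_hom_def one_pCons)

lemma unital_hom_const_poly_id: "unital_hom (\<lambda>c. [:c:])"
  using unital_hom_const_poly[of "\<lambda>c. c"] by (simp add: unital_hom_def)

lemma unital_hom_poly: "unital_hom (\<lambda>p. poly p u)"
  by (simp add: unital_hom_def)

lemma unital_hom_Fract: "unital_hom (\<lambda>p. Fract p 1)"
  by (simp add: unital_hom_def One_fract_def)

lemma unital_hom_to_ac: "unital_hom to_ac"
  by (simp add: unital_hom_def)

lemma Fract_1_eq_0_iff: "Fract p 1 = 0 \<longleftrightarrow> p = 0"
  by (simp add: Zero_fract_def eq_fract)

lemma unital_hom_field_inj: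
  fixes h :: "'a::field \<Rightarrow> 'b::{comm_ring_1, zero_neq_one}"
  assumes "unital_hom h" shows "h x = 0 \<longleftrightarrow> x = 0"
proof
  assume "h x = 0"
  show "x = 0"
  proof (rule ccontr)
    assume "x \<noteq> 0"
    then have "h (x * inverse x) = 1" by (simp add: unital_hom_1[OF assms])
    then show False by (simp add: unital_hom_mult[OF assms] \<open>h x = 0\<close>)
  qed
qed (simp add: unital_hom_0[OF assms])

section \<open>Evaluation of polynomials\<close>

definition monomial_value :: "('v::finite \<Rightarrow> 'r::comm_ring_1) \<Rightarrow> ('v \<Rightarrow>\<^sub>0 nat) \<Rightarrow> 'r" where
  "monomial_value x m = (\<Prod>i\<in>UNIV. x i ^ Poly_Mapping.lookup m i)"

lemma monomial_value_0 [simp]: "monomial_value x 0 = 1"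
  by (simp add: monomial_value_def)

lemma monomial_value_add: "monomial_value x (m + m') = monomial_value x m * monomial_value x m'"
  by (simp add: monomial_value_def lookup_add power_add prod.distrib)

lemma monomial_value_single: "monomial_value x (Poly_Mapping.single i 1) = x i"
proof -
  have "(\<Prod>j\<in>UNIV. x j ^ Poly_Mapping.lookup (Poly_Mapping.single i 1) j) = (\<Prod>j\<in>UNIV. if j = i then x j else 1)"
    by (rule prod.cong) (auto simp: lookup_single)
  then show ?thesis by (simp add: monomial_value_def)
qed

lemma monomial_value_hom: "unital_hom g \<Longrightarrow> g (monomial_value x m) = monomial_value (\<lambda>i. g (x i)) m"
  by (simp add: monomial_value_def unital_hom_simps)

lemma eval_mpoly_alt:
  "eval_mpoly h x p = (\<Sum>m\<in>Poly_Mapping.keys p. h (Poly_Mapping.lookup p m) * monomial_value x m)"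
  by (simp add: eval_mpoly_def monomial_value_def)

lemma eval_mpoly_superset:
  assumes "h 0 = 0" "finite A" "Poly_Mapping.keys p \<subseteq> A"
  shows "eval_mpoly h x p = (\<Sum>m\<in>A. h (Poly_Mapping.lookup p m) * monomial_value x m)"
  unfolding eval_mpoly_alt
  by (rule sum.mono_neutral_left) (use assms in \<open>auto simp: in_keys_iff\<close>)

lemma eval_mpoly_add:
  assumes "unital_hom h"
  shows "eval_mpoly h x (p + q) = eval_mpoly h x p + eval_mpoly h x q"
proof -
  let ?A = "Poly_Mapping.keys p \<union> Poly_Mapping.keys q"
  note * = eval_mpoly_superset[where h = h and A = ?A, OF unital_hom_0[OF assms]]
  show ?thesis
    using keys_add[of p q]
    by (simp add: * lookup_add unital_hom_simps[OF assms] sum.distrib distrib_right)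
qed

lemma eval_mpoly_single:
  "unital_hom h \<Longrightarrow> eval_mpoly h x (Poly_Mapping.single m c) = h c * monomial_value x m"
  by (subst eval_mpoly_superset[of h "{m}"]) (auto simp: unital_hom_0)

lemma eval_mpoly_sum:
  "unital_hom h \<Longrightarrow> eval_mpoly h x (sum g A) = (\<Sum>a\<in>A. eval_mpoly h x (g a))"
  by (induction A rule: infinite_finite_induct)
    (auto simp: eval_mpoly_add, auto simp: eval_mpoly_alt)

lemma mpoly_eq_sum_monomials:
  "p = (\<Sum>m\<in>Poly_Mapping.keys p. Poly_Mapping.single m (Poly_Mapping.lookup p m))"
  by (rule poly_mapping_eqI)
    (simp add: lookup_sum lookup_single when_def in_keys_iff if_distrib sum.delta' cong: if_cong)

lemma mult_eq_sum_monomials: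
  "p * q = (\<Sum>m\<in>Poly_Mapping.keys p. \<Sum>m'\<in>Poly_Mapping.keys q.
     Poly_Mapping.single (m + m') (Poly_Mapping.lookup p m * Poly_Mapping.lookup q m'))"
  by (subst mpoly_eq_sum_monomials[of p], subst mpoly_eq_sum_monomials[of q])
    (simp only: sum_product mult_single)

lemma eval_mpoly_mult:
  assumes h: "unital_hom h"
  shows "eval_mpoly h x (p * q) = eval_mpoly h x p * eval_mpoly h x q"
proof -
  have "eval_mpoly h x (p * q) = (\<Sum>m\<in>Poly_Mapping.keys p. \<Sum>m'\<in>Poly_Mapping.keys q.
      (h (Poly_Mapping.lookup p m) * monomial_value x m) * (h (Poly_Mapping.lookup q m') * monomial_value x m'))"
    by (simp add: mult_eq_sum_monomials eval_mpoly_sum[OF h] eval_mpoly_single[OF h] unital_hom_mult[OF h]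
        monomial_value_add ac_simps)
  then show ?thesis
    by (simp add: eval_mpoly_alt sum_product)
qed

lemma eval_mpoly_const: "unital_hom h \<Longrightarrow> eval_mpoly h x (const c) = h c"
  by (simp add: const_def eval_mpoly_single)

lemma eval_mpoly_var: "unital_hom h \<Longrightarrow> eval_mpoly h x (var i) = x i"
  by (simp only: var_def eval_mpoly_single monomial_value_single unital_hom_1 mult_1_left)

lemma unital_hom_eval: "unital_hom h \<Longrightarrow> unital_hom (eval_mpoly h x)"
  unfolding unital_hom_def[of "eval_mpoly h x"]
  using eval_mpoly_const[of h x 1] unital_hom_1[of h]
  by (simp add: eval_mpoly_add eval_mpoly_mult const_def)

lemmas eval_mpoly_simps = unital_hom_simps[OF unital_hom_eval] eval_mpoly_const eval_mpoly_var

lemma hom_eval_mpoly: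
  "unital_hom g \<Longrightarrow> g (eval_mpoly h x p) = eval_mpoly (\<lambda>c. g (h c)) (\<lambda>i. g (x i)) p"
  by (simp add: eval_mpoly_alt unital_hom_simps monomial_value_hom)

lemma eval_mpoly_eval:
  assumes "unital_hom h"
  shows "eval_mpoly h x (eval_mpoly const y p) = eval_mpoly h (\<lambda>i. eval_mpoly h x (y i)) p"
  by (simp add: hom_eval_mpoly[OF unital_hom_eval[OF assms]] eval_mpoly_const[OF assms])

lemma prod_var_power:
  "(\<Prod>i\<in>A. var i ^ Poly_Mapping.lookup m i) =
     (Poly_Mapping.single (\<Sum>i\<in>A. Poly_Mapping.single i (Poly_Mapping.lookup m i)) 1 :: ('v, 'k::comm_ring_1) mpoly)"
proof -
  have *: "var i ^ e = (Poly_Mapping.single (Poly_Mapping.single i e) 1 :: ('v, 'k) mpoly)" for i e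
    by (induction e) (simp_all add: var_def mult_single flip: single_add)
  show ?thesis
    by (induction A rule: infinite_finite_induct) (simp_all add: * mult_single)
qed

lemma monomial_value_var:
  "monomial_value var m = (Poly_Mapping.single m 1 :: ('v::finite, 'k::comm_ring_1) mpoly)"
proof -
  have "(\<Sum>i\<in>UNIV. Poly_Mapping.single i (Poly_Mapping.lookup m i)) = m"
    by (rule poly_mapping_eqI) (simp add: lookup_sum lookup_single when_def)
  then show ?thesis by (simp add: monomial_value_def prod_var_power)
qed

lemma eval_mpoly_const_var: "eval_mpoly const var p = p"
  by (subst (2) mpoly_eq_sum_monomials[of p])
    (simp add: eval_mpoly_alt monomial_value_var const_def mult_single)

text \<open>Polynomials are built from constants and variables, which is what evaluating a polynomial at its own variables expresses.\<close>

lemma mpoly_induct [case_names const var add mult]: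
  fixes p :: "('v::finite, 'k::comm_ring_1) mpoly"
  assumes c: "\<And>c. P (const c)" and v: "\<And>i. P (var i)"
    and a: "\<And>p q. P p \<Longrightarrow> P q \<Longrightarrow> P (p + q)" and m: "\<And>p q. P p \<Longrightarrow> P q \<Longrightarrow> P (p * q)"
  shows "P p"
proof -
  have 0: "P 0" and 1: "P 1" using c[of 0] c[of 1] by (simp_all add: const_def)
  have s: "P (sum g A)" if "\<And>x. P (g x)" for g and A :: "('v \<Rightarrow>\<^sub>0 nat) set"
    by (induction A rule: infinite_finite_induct) (auto intro: 0 a that)
  have pw: "P (var i ^ e)" for i e by (induction e) (auto intro: 1 m v)
  have pr: "P (\<Prod>i\<in>A. var i ^ Poly_Mapping.lookup mm i)" for A mm
    by (induction A rule: infinite_finite_induct) (auto intro: 1 m pw)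
  have "P (eval_mpoly const var p)"
    unfolding eval_mpoly_def by (intro s m c pr)
  then show ?thesis by (simp add: eval_mpoly_const_var)
qed

section \<open>Gradings\<close>

lemma wdeg_add: "wdeg a (m + m') = wdeg a m + wdeg a m'"
  by (simp add: wdeg_def lookup_add distrib_left sum.distrib)

lemma lookup_hom_component:
  "Poly_Mapping.lookup (hom_component a e p) m = (if wdeg a m = e then Poly_Mapping.lookup p m else 0)"
proof -
  let ?S = "{m \<in> Poly_Mapping.keys p. wdeg a m = e}"
  have "Poly_Mapping.lookup (hom_component a e p) m = (\<Sum>m'\<in>?S. if m' = m then Poly_Mapping.lookup p m' else 0)"
    unfolding hom_component_def lookup_sum lookup_single by (rule sum.cong) (auto simp: when_def)
  also have "\<dots> = (if m \<in> ?S then Poly_Mapping.lookup p m else 0)"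
    by (rule sum.delta) simp
  finally show ?thesis by (auto simp: in_keys_iff)
qed

lemma keys_hom_component: "Poly_Mapping.keys (hom_component a e p) = {m \<in> Poly_Mapping.keys p. wdeg a m = e}"
  by (auto simp: in_keys_iff lookup_hom_component split: if_splits)

lemma homogeneous_hom_component: "homogeneous a e (hom_component a e p)"
  by (simp add: homogeneous_def keys_hom_component)

lemma hom_component_hom_component:
  "hom_component a e (hom_component a e' p) = (if e = e' then hom_component a e p else 0)"
  by (rule poly_mapping_eqI) (simp add: lookup_hom_component)

lemma hom_component_homogeneous:
  "homogeneous a d p \<Longrightarrow> hom_component a e p = (if e = d then p else 0)"
  by (rule poly_mapping_eqI) (simp add: lookup_hom_component, metis homogeneous_def in_keys_iff)

lemma mpoly_eq_0_by_components:
  assumes "\<And>e. hom_component a e p = 0" shows "p = 0"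
proof (rule poly_mapping_eqI)
  fix m show "Poly_Mapping.lookup p m = Poly_Mapping.lookup 0 m"
    using lookup_hom_component[of a "wdeg a m" p m] by (simp add: assms)
qed

lemma homogeneous_0 [simp]: "homogeneous a e 0"
  by (simp add: homogeneous_def)

lemma homogeneous_const: "homogeneous a 0 (const c)"
  by (simp add: homogeneous_def const_def wdeg_def)

lemma wdeg_single: "wdeg a (Poly_Mapping.single i n) = a i * n"
proof -
  have "wdeg a (Poly_Mapping.single i n) = (\<Sum>j\<in>UNIV. if j = i then a j * n else 0)"
    unfolding wdeg_def lookup_single by (rule sum.cong) (auto simp: when_def)
  then show ?thesis by simp
qed

lemma mdeg_eq_0_iff: "mdeg m = 0 \<longleftrightarrow> m = 0"
  by (auto simp: wdeg_def poly_mapping_eq_iff fun_eq_iff)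

lemma homogeneous_var: "homogeneous a (a i) (var i)"
  by (simp add: homogeneous_def var_def wdeg_single)

lemma homogeneous_add: "homogeneous a e p \<Longrightarrow> homogeneous a e q \<Longrightarrow> homogeneous a e (p + q)"
  using keys_add[of p q] by (auto simp: homogeneous_def)

lemma homogeneous_uminus:
  fixes p :: "('v::finite, 'k::comm_ring_1) mpoly"
  shows "homogeneous a e p \<Longrightarrow> homogeneous a e (- p)"
  by (auto simp: homogeneous_def in_keys_iff)

lemma homogeneous_diff:
  fixes p :: "('v::finite, 'k::comm_ring_1) mpoly"
  shows "homogeneous a e p \<Longrightarrow> homogeneous a e q \<Longrightarrow> homogeneous a e (p - q)"
  using homogeneous_add[OF _ homogeneous_uminus, of a e p q] by simp

lemma homogeneous_mult: "homogeneous a d p \<Longrightarrow> homogeneous a e q \<Longrightarrow> homogeneous a (d + e) (p * q)"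
  using keys_mult[of p q] by (fastforce simp: homogeneous_def wdeg_add)

lemma homogeneous_1 [simp]: "homogeneous a 0 (1 :: ('v::finite, 'k::comm_ring_1) mpoly)"
  by (simp add: homogeneous_def wdeg_def)

lemma homogeneous_power:
  fixes p :: "('v::finite, 'k::comm_ring_1) mpoly"
  shows "homogeneous a d p \<Longrightarrow> homogeneous a (n * d) (p ^ n)"
  by (induction n) (auto intro: homogeneous_mult)

lemma homogeneous_sum: "(\<And>x. x \<in> A \<Longrightarrow> homogeneous a d (g x)) \<Longrightarrow> homogeneous a d (sum g A)"
  by (induction A rule: infinite_finite_induct) (auto intro: homogeneous_add)

lemma homogeneous_prod:
  fixes g :: "'b \<Rightarrow> ('v::finite, 'k::comm_ring_1) mpoly"
  shows "(\<And>x. homogeneous a (d x) (g x)) \<Longrightarrow> homogeneous a (sum d A) (prod g A)"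
  by (induction A rule: infinite_finite_induct) (auto intro: homogeneous_mult)

lemma homogeneous_eval:
  fixes y :: "'v::finite \<Rightarrow> ('u::finite, 'k::comm_ring_1) mpoly"
  assumes G: "homogeneous a d G" and y: "\<And>i. homogeneous b (e * a i) (y i)"
  shows "homogeneous b (e * d) (eval_mpoly const y G)"
  unfolding eval_mpoly_def
proof (rule homogeneous_sum)
  fix m assume "m \<in> Poly_Mapping.keys G"
  then have "wdeg a m = d"
    using G by (simp add: homogeneous_def)
  then have d: "(\<Sum>i\<in>UNIV. Poly_Mapping.lookup m i * (e * a i)) = e * d"
    by (simp add: wdeg_def sum_distrib_left ac_simps flip: \<open>wdeg a m = d\<close>)
  have "homogeneous b (0 + (\<Sum>i\<in>UNIV. Poly_Mapping.lookup m i * (e * a i)))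
     (const (Poly_Mapping.lookup G m) * (\<Prod>i\<in>UNIV. y i ^ Poly_Mapping.lookup m i))"
    by (intro homogeneous_mult homogeneous_const homogeneous_prod homogeneous_power y)
  then show "homogeneous b (e * d)
      (const (Poly_Mapping.lookup G m) * (\<Prod>i\<in>UNIV. y i ^ Poly_Mapping.lookup m i))"
    by (simp add: d)
qed

lemma monomial_value_scale: "monomial_value (\<lambda>i. t ^ a i * x i) m = t ^ wdeg a m * monomial_value x m"
  by (simp add: monomial_value_def wdeg_def power_mult_distrib prod.distrib power_sum flip: power_mult)

lemma eval_homogeneous_scale:
  assumes "homogeneous a d G"
  shows "eval_mpoly h (\<lambda>i. t ^ a i * x i) G = t ^ d * eval_mpoly h x G"
  using assms unfolding eval_mpoly_alt monomial_value_scale homogeneous_def sum_distrib_left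
  by (intro sum.cong) (simp_all add: ac_simps)

text \<open>
  The value at \<open>(t^a\<^sub>i x\<^sub>i)\<close> for a new variable \<open>t\<close>.  The powers of \<open>t\<close> keep the homogeneous
  components apart, so that statements about all components become statements about one ring
  homomorphism.
\<close>

definition graded_eval ::
  "('v::finite \<Rightarrow> nat) \<Rightarrow> ('k::zero \<Rightarrow> 'r::comm_ring_1) \<Rightarrow> ('v \<Rightarrow> 'r) \<Rightarrow> ('v, 'k) mpoly \<Rightarrow> 'r poly" where
  "graded_eval a h x G = eval_mpoly (\<lambda>c. [:h c:]) (\<lambda>i. Polynomial.monom (x i) (a i)) G"

lemma coeff_graded_eval:
  "poly.coeff (graded_eval a h x G) e = eval_mpoly h x (hom_component a e G)"
proof -
  have m: "monomial_value (\<lambda>i. Polynomial.monom (x i) (a i)) m = Polynomial.monom (monomial_value x m) (wdeg a m)" for m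
  proof -
    have "monomial_value (\<lambda>i. Polynomial.monom (x i) (a i)) m = monomial_value (\<lambda>i. Polynomial.monom 1 1 ^ a i * [:x i:]) m"
      by (rule arg_cong[of _ _ "\<lambda>x. monomial_value x m"]) (simp add: fun_eq_iff monom_power monom_altdef)
    also have "\<dots> = Polynomial.monom 1 1 ^ wdeg a m * monomial_value (\<lambda>i. [:x i:]) m"
      by (rule monomial_value_scale)
    also have "monomial_value (\<lambda>i. [:x i:]) m = [:monomial_value x m:]"
      by (rule monomial_value_hom[OF unital_hom_const_poly_id, symmetric])
    finally show ?thesis by (simp add: monom_power monom_altdef mult.commute)
  qed
  show ?thesis
    by (simp add: graded_eval_def eval_mpoly_alt m coeff_sum keys_hom_component lookup_hom_component
        sum.inter_filter mult_monom smult_monom flip: monom_0)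
qed

lemma unital_hom_graded_eval: "unital_hom h \<Longrightarrow> unital_hom (graded_eval a h x)"
  unfolding graded_eval_def by (intro unital_hom_eval unital_hom_const_poly)

section \<open>Polynomial rings are completely integrally closed\<close>

text \<open>
  Exponent vectors are compared lexicographically.  As they have finitely many entries, they can be
  read as lists of a fixed length.
\<close>

lemma wf_monomial_order: "wf {(m, m' :: 'v::{finite,linorder} \<Rightarrow>\<^sub>0 nat). m < m'}"
proof (rule wf_subset)
  let ?L = "sorted_list_of_set (UNIV :: 'v set)"
  let ?f = "\<lambda>m :: 'v \<Rightarrow>\<^sub>0 nat. map (Poly_Mapping.lookup m) ?L"
  show "wf (inv_image (lexn less_than (length ?L)) ?f)"
    by (intro wf_inv_image wf_lexn wf_less_than)
  show "{(m, m' :: 'v \<Rightarrow>\<^sub>0 nat). m < m'} \<subseteq> inv_image (lexn less_than (length ?L)) ?f"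
  proof clarify
    fix m m' :: "'v \<Rightarrow>\<^sub>0 nat"
    assume "m < m'"
    then obtain k where k: "Poly_Mapping.lookup m k < Poly_Mapping.lookup m' k"
      and eq: "\<And>k'. k' < k \<Longrightarrow> Poly_Mapping.lookup m k' = Poly_Mapping.lookup m' k'"
      by (auto simp: less_poly_mapping.rep_eq less_fun_def)
    have "k \<in> set ?L" by simp
    then obtain xs ys where L: "?L = xs @ k # ys" by (meson split_list)
    have "sorted_wrt (<) ?L" by (rule strict_sorted_list_of_set)
    then have "\<forall>k' \<in> set xs. k' < k"
      unfolding L sorted_wrt_append by simp
    then have "map (Poly_Mapping.lookup m) xs = map (Poly_Mapping.lookup m') xs"
      using eq by simp
    then show "(m, m') \<in> inv_image (lexn less_than (length ?L)) ?f"
      using k unfolding L in_inv_image lexn_conv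
      by (intro CollectI case_prodI conjI exI[of _ "map (Poly_Mapping.lookup m') xs"]
          exI[of _ "Poly_Mapping.lookup m k"] exI[of _ "Poly_Mapping.lookup m' k"]
          exI[of _ "map (Poly_Mapping.lookup m) ys"] exI[of _ "map (Poly_Mapping.lookup m') ys"]) simp_all
  qed
qed

definition lead :: "('v::linorder, 'k::zero) mpoly \<Rightarrow> ('v \<Rightarrow>\<^sub>0 nat)" where
  "lead p = Max (Poly_Mapping.keys p)"

lemma lead_in_keys: "p \<noteq> 0 \<Longrightarrow> lead p \<in> Poly_Mapping.keys p"
  unfolding lead_def by (rule Max_in) (auto simp: poly_mapping_eq_iff in_keys_iff fun_eq_iff)

lemma le_lead: "m \<in> Poly_Mapping.keys p \<Longrightarrow> m \<le> lead p"
  unfolding lead_def by simp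

lemma lookup_mult_lead:
  fixes p q :: "('v::{finite,linorder}, 'k::field) mpoly"
  assumes "p \<noteq> 0" "q \<noteq> 0"
  shows "Poly_Mapping.lookup (p * q) (lead p + lead q) =
     Poly_Mapping.lookup p (lead p) * Poly_Mapping.lookup q (lead q)"
proof -
  let ?c = "\<lambda>m m'. Poly_Mapping.lookup p m * Poly_Mapping.lookup q m'"
  have "Poly_Mapping.lookup (p * q) (lead p + lead q) =
      (\<Sum>m\<in>Poly_Mapping.keys p. \<Sum>m'\<in>Poly_Mapping.keys q. ?c m m' when m + m' = lead p + lead q)"
    by (simp add: mult_eq_sum_monomials lookup_sum lookup_single)
  also have "\<dots> = (\<Sum>m\<in>Poly_Mapping.keys p. \<Sum>m'\<in>Poly_Mapping.keys q.
      if m' = lead q then (if m = lead p then ?c m m' else 0) else 0)"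
  proof (intro sum.cong refl)
    fix m m' assume "m \<in> Poly_Mapping.keys p" "m' \<in> Poly_Mapping.keys q"
    then have "m \<le> lead p" "m' \<le> lead q" by (auto intro: le_lead)
    then have "m + m' = lead p + lead q \<longleftrightarrow> m = lead p \<and> m' = lead q"
      by (metis add_le_less_mono add_less_le_mono less_irrefl order_le_imp_less_or_eq)
    then show "(?c m m' when m + m' = lead p + lead q) =
        (if m' = lead q then (if m = lead p then ?c m m' else 0) else 0)"
      by (auto simp: when_def)
  qed
  also have "\<dots> = ?c (lead p) (lead q)"
    by (simp add: lead_in_keys assms)
  finally show ?thesis .
qed

lemma lead_mult:
  fixes p q :: "('v::{finite,linorder}, 'k::field) mpoly"
  assumes "p \<noteq> 0" "q \<noteq> 0"
  shows "lead (p * q) = lead p + lead q"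
  unfolding lead_def[of "p * q"]
proof (rule Max_eqI)
  fix m assume "m \<in> Poly_Mapping.keys (p * q)"
  then obtain m1 m2 where "m = m1 + m2" "m1 \<in> Poly_Mapping.keys p" "m2 \<in> Poly_Mapping.keys q"
    using keys_mult[of p q] by blast
  then show "m \<le> lead p + lead q" by (auto intro: add_mono le_lead)
next
  show "lead p + lead q \<in> Poly_Mapping.keys (p * q)"
    using lead_in_keys[of p] lead_in_keys[of q] assms
    by (simp add: in_keys_iff lookup_mult_lead)
qed simp

lemma lookup_lead_power:
  fixes p :: "('v::{finite,linorder}, 'k::field) mpoly"
  assumes "p \<noteq> 0"
  shows "Poly_Mapping.lookup (lead (p ^ n)) i = n * Poly_Mapping.lookup (lead p) i"
proof (induction n)
  case 0
  have "lead (1 :: ('v, 'k) mpoly) = 0" by (simp add: lead_def)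
  then show ?case by simp
next
  case (Suc n)
  then show ?case using assms by (simp add: lead_mult lookup_add)
qed

text \<open>
  The assumption says that all powers of \<open>g = p/q\<close> have the common denominator \<open>q\<close>.  Comparing leading
  monomials, \<open>n\<close> times the leading exponent of \<open>g\<close> is bounded below independently of \<open>n\<close>, so the
  leading term \<open>t\<close> of \<open>g\<close> is a monomial of the polynomial ring.  Since \<open>t\<close> is a polynomial,
  \<open>g - t\<close> satisfies the assumption again, with a smaller leading monomial.  This replaces
  unique factorization in the proof that \<open>f\<close> is not a square.
\<close>

lemma completely_integrally_closed:
  fixes p q :: "('v::{finite,linorder}, 'k::field) mpoly"
  assumes "q \<noteq> 0" "\<And>n. q ^ n dvd q * p ^ n"
  shows "q dvd p"
  using assms(2)
proof (induction "lead p" arbitrary: p rule: wf_induct_rule[OF wf_monomial_order])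
  case (1 p)
  show ?case
  proof (cases "p = 0")
    case False
    have le: "Poly_Mapping.lookup (lead q) i \<le> Poly_Mapping.lookup (lead p) i" (is "?a \<le> ?b") for i
    proof -
      \<comment> \<open>The inequality \<open>n a \<le> a + n b\<close> for \<open>n = a + 1\<close> already forces \<open>a \<le> b\<close>.\<close>
      obtain s where s: "q * p ^ (?a + 1) = q ^ (?a + 1) * s"
        using 1(2)[of "?a + 1"] by (auto elim: dvdE)
      then have "s \<noteq> 0" using False assms(1) by auto
      have "lead (q * p ^ (?a + 1)) = lead q + lead (p ^ (?a + 1))"
        "lead (q ^ (?a + 1) * s) = lead (q ^ (?a + 1)) + lead s"
        by (intro lead_mult power_not_zero assms(1) False \<open>s \<noteq> 0\<close>)+
      then have "Poly_Mapping.lookup (lead q + lead (p ^ (?a + 1))) i = Poly_Mapping.lookup (lead (q ^ (?a + 1)) + lead s) i"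
        by (simp only: s)
      then have "?a + (?a + 1) * ?b = (?a + 1) * ?a + Poly_Mapping.lookup (lead s) i"
        by (simp only: lookup_add lookup_lead_power[OF False] lookup_lead_power[OF assms(1)])
      then have *: "(?a + 1) * ?a \<le> ?a + (?a + 1) * ?b" by simp
      show ?thesis
      proof (rule ccontr)
        assume "\<not> ?thesis"
        then have "(?a + 1) * (?b + 1) \<le> (?a + 1) * ?a" by (intro mult_le_mono2) simp
        with * show False by (simp add: algebra_simps)
      qed
    qed
    define t :: "('v, 'k) mpoly" where "t = Poly_Mapping.single (lead p - lead q)
      (Poly_Mapping.lookup p (lead p) / Poly_Mapping.lookup q (lead q))"
    have c: "Poly_Mapping.lookup p (lead p) \<noteq> 0" "Poly_Mapping.lookup q (lead q) \<noteq> 0"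
      using lead_in_keys False assms(1) by (auto simp: in_keys_iff)
    have "t \<noteq> 0" unfolding t_def using c
      by (metis divide_eq_0_iff lookup_single_eq lookup_zero)
    have lt: "lead t = lead p - lead q"
      unfolding lead_def[of t] by (simp add: t_def c)
    have sum: "lead t + lead q = lead p"
      unfolding lt using le by (intro poly_mapping_eqI) (simp add: lookup_add lookup_minus)
    have ltq: "lead (q * t) = lead p"
      using lead_mult[OF assms(1) \<open>t \<noteq> 0\<close>] sum by (simp add: add.commute)
    have "Poly_Mapping.lookup t (lead t) = Poly_Mapping.lookup p (lead p) / Poly_Mapping.lookup q (lead q)"
      unfolding lt unfolding t_def by simp
    then have "Poly_Mapping.lookup (q * t) (lead p) = Poly_Mapping.lookup p (lead p)"
      using lookup_mult_lead[OF assms(1) \<open>t \<noteq> 0\<close>] sum c by (simp add: add.commute)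
    then have p0: "Poly_Mapping.lookup (p - q * t) (lead p) = 0" by (simp add: lookup_minus)
    have div: "q ^ n dvd q * (p - q * t) ^ n" for n
    proof -
      have "q * (p - q * t) ^ n = q * (p + q * (- t)) ^ n" by simp
      also have "\<dots> = (\<Sum>k\<le>n. of_nat (n choose k) * (q * p ^ k) * (q ^ (n - k) * (- t) ^ (n - k)))"
        unfolding binomial_ring sum_distrib_left power_mult_distrib by (simp only: ac_simps)
      finally have "q * (p - q * t) ^ n = \<dots>" .
      moreover have "q ^ n dvd of_nat (n choose k) * (q * p ^ k) * (q ^ (n - k) * (- t) ^ (n - k))" if "k \<le> n" for k
      proof -
        have "q ^ k * q ^ (n - k) dvd (q * p ^ k) * (q ^ (n - k) * (- t) ^ (n - k))"
          by (intro mult_dvd_mono 1(2)) simp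
        then show ?thesis using that by (simp add: mult.assoc dvd_mult flip: power_add)
      qed
      ultimately show ?thesis by (simp only:) (rule dvd_sum, simp)
    qed
    have "q dvd p - q * t"
    proof (cases "p - q * t = 0")
      case nz: False
      have "lead (p - q * t) \<in> Poly_Mapping.keys p \<union> Poly_Mapping.keys (q * t)"
        using lead_in_keys[OF nz] by (auto simp: in_keys_iff lookup_minus)
      then have "lead (p - q * t) \<le> lead p" using le_lead ltq by (metis UnE)
      moreover have "lead (p - q * t) \<noteq> lead p"
        using lead_in_keys[OF nz] p0 by (auto simp: in_keys_iff)
      ultimately show ?thesis using 1(1)[of "p - q * t"] div by simp
    qed simp
    then have "q dvd (p - q * t) + q * t" by (intro dvd_add) simp_all
    then show ?thesis by simp
  qed simp
qed

text \<open>
  If \<open>f = (p/q)\<^sup>2\<close>, then each power of \<open>p/q\<close> is a power of \<open>f\<close> times 1 or \<open>p/q\<close>, so \<open>q\<close> is a common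
  denominator and \<open>p/q\<close> is a polynomial.  Its square \<open>f\<close> is squarefree only if it is a unit.
\<close>

lemma squarefree_ratio_of_squares:
  fixes f p q :: "('v::{finite,linorder}, 'k::field) mpoly"
  assumes "squarefree f" "q \<noteq> 0" "p\<^sup>2 = f * q\<^sup>2"
  shows "f dvd 1"
proof -
  have sq: "p ^ (2 * l) = f ^ l * q ^ (2 * l)" for l
    unfolding power_mult assms(3) by (rule power_mult_distrib)
  have "q ^ n dvd q * p ^ n" for n
  proof (cases "even n")
    case True
    then obtain l where n: "n = 2 * l" by (elim evenE)
    have "q * p ^ n = q ^ n * (q * f ^ l)" unfolding n sq by (simp only: ac_simps)
    then show ?thesis by (metis dvd_triv_left)
  next
    case False
    then obtain l where n: "n = 2 * l + 1" by (elim oddE)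
    have "q * p ^ n = q ^ n * (p * f ^ l)" unfolding n power_add power_one_right sq by (simp only: ac_simps)
    then show ?thesis by (metis dvd_triv_left)
  qed
  then have "q dvd p" using assms(2) by (rule completely_integrally_closed[rotated])
  then obtain g where "p = q * g" by (elim dvdE)
  then have "f = g\<^sup>2" using assms(2,3) by (simp add: power_mult_distrib)
  then have "g dvd 1" using assms(1) by (simp add: squarefree_def)
  then show ?thesis using mult_dvd_mono[of g 1 g 1] by (simp add: \<open>f = g\<^sup>2\<close> power2_eq_square)
qed

lemma lead_eq_0_imp_const:
  fixes f :: "('v::{finite,linorder}, 'k::field) mpoly"
  assumes "lead f = 0" shows "f = const (Poly_Mapping.lookup f 0)"
proof -
  have "0 \<le> m" for m :: "'v \<Rightarrow>\<^sub>0 nat"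
    by (auto simp: less_poly_mapping.rep_eq less_fun_def not_less[symmetric])
  then have "Poly_Mapping.keys f \<subseteq> {0}"
    using le_lead[of _ f] assms by (metis antisym singletonI subsetI)
  then show ?thesis
    by (intro poly_mapping_eqI) (auto simp: const_def lookup_single when_def in_keys_iff)
qed

lemma is_unit_mpoly_imp_const:
  fixes f :: "('v::{finite,linorder}, 'k::field) mpoly"
  assumes "f dvd 1" shows "\<exists>c. f = const c"
proof -
  obtain g where g: "1 = f * g" using assms by (elim dvdE)
  then have "f \<noteq> 0" "g \<noteq> 0" by auto
  have "lead (1 :: ('v, 'k) mpoly) = 0" by (simp add: lead_def)
  then have "lead f + lead g = 0"
    using lead_mult[OF \<open>f \<noteq> 0\<close> \<open>g \<noteq> 0\<close>] by (simp only: g)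
  then have "Poly_Mapping.lookup (lead f + lead g) i = 0" for i
    by simp
  then have "lead f = 0"
    by (intro poly_mapping_eqI) (simp add: lookup_add)
  then show ?thesis using lead_eq_0_imp_const by blast
qed

text \<open>Splitting off the square of a nonunit lowers the degree of the leading monomial.\<close>

lemma ex_square_times_squarefree:
  fixes p :: "('v::{finite,linorder}, 'k::field) mpoly"
  assumes "p \<noteq> 0"
  shows "\<exists>s f. p = s\<^sup>2 * f \<and> s \<noteq> 0 \<and> squarefree f"
  using assms
proof (induction "mdeg (lead p)" arbitrary: p rule: less_induct)
  case (less p)
  show ?case
  proof (cases "squarefree p")
    case True
    then show ?thesis by (intro exI[of _ 1] exI[of _ p]) simp
  next
    case False
    then obtain x p' where x: "\<not> x dvd 1" and p: "p = x\<^sup>2 * p'"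
      unfolding squarefree_def by (metis dvdE)
    then have "x \<noteq> 0" "p' \<noteq> 0" using less(2) by auto
    have "mdeg (lead x) \<noteq> 0"
    proof
      assume "mdeg (lead x) = 0"
      then have "lead x = 0" by (simp only: mdeg_eq_0_iff)
      then obtain c where c: "x = const c" using lead_eq_0_imp_const by blast
      then have "c \<noteq> 0" using \<open>x \<noteq> 0\<close> by (auto simp: const_def)
      then have "x * const (inverse c) = 1" by (simp add: c const_def mult_single)
      then show False using x by (metis dvd_triv_left)
    qed
    moreover have "mdeg (lead p) = 2 * mdeg (lead x) + mdeg (lead p')"
      using \<open>x \<noteq> 0\<close> \<open>p' \<noteq> 0\<close> by (simp add: p power2_eq_square lead_mult wdeg_add)
    ultimately obtain s f where "p' = s\<^sup>2 * f" "s \<noteq> 0" "squarefree f"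
      using less(1)[of p'] \<open>p' \<noteq> 0\<close> by auto
    then show ?thesis
      using \<open>x \<noteq> 0\<close> by (intro exI[of _ "x * s"] exI[of _ f]) (simp add: p power_mult_distrib)
  qed
qed

section \<open>Rationalizable square roots and substitutions\<close>

lemma k_algebra_hom_imp_unital_hom: "k_algebra_hom \<phi> \<Longrightarrow> unital_hom \<phi>"
  by (simp add: k_algebra_hom_def unital_hom_def)

lemma rationalizable_times_square:
  fixes g s :: "('n::linorder, 'k::field) mpoly fract"
  assumes "s \<noteq> 0"
  shows "rationalizable (g * s\<^sup>2) \<longleftrightarrow> rationalizable g"
proof -
  have "(\<exists>h. \<phi> (g * s\<^sup>2) = h\<^sup>2) \<longleftrightarrow> (\<exists>h. \<phi> g = h\<^sup>2)" if "k_algebra_hom \<phi>" for \<phi>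
  proof -
    note \<phi> = k_algebra_hom_imp_unital_hom[OF that]
    have s: "\<phi> s \<noteq> 0" using unital_hom_field_inj[OF \<phi>] assms by blast
    have eq: "\<phi> (g * s\<^sup>2) = \<phi> g * (\<phi> s)\<^sup>2"
      by (simp add: unital_hom_mult[OF \<phi>] unital_hom_power[OF \<phi>])
    show ?thesis
    proof
      assume "\<exists>h. \<phi> (g * s\<^sup>2) = h\<^sup>2"
      then obtain h where "\<phi> g * (\<phi> s)\<^sup>2 = h\<^sup>2" using eq by auto
      then have "\<phi> g = (h / \<phi> s)\<^sup>2" using s by (simp add: power_divide field_simps)
      then show "\<exists>h. \<phi> g = h\<^sup>2" ..
    next
      assume "\<exists>h. \<phi> g = h\<^sup>2"
      then obtain h where "\<phi> g = h\<^sup>2" ..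
      then have "\<phi> (g * s\<^sup>2) = (h * \<phi> s)\<^sup>2" by (simp add: eq power_mult_distrib)
      then show "\<exists>h. \<phi> (g * s\<^sup>2) = h\<^sup>2" ..
    qed
  qed
  then show ?thesis unfolding rationalizable_def by blast
qed

lemma rationalizable_Fract_iff_squarefree:
  fixes p q :: "('n::{finite,linorder}, 'k::field) mpoly"
  assumes "q \<noteq> 0"
  shows "\<exists>f :: ('n, 'k) mpoly. squarefree f \<and> (rationalizable (Fract p q) \<longleftrightarrow> rationalizable (Fract f 1))"
proof (cases "p = 0")
  case True
  have id: "k_algebra_hom (\<lambda>x :: ('n, 'k) mpoly fract. x)" by (simp add: k_algebra_hom_def)
  have "rationalizable (Fract p q)" unfolding rationalizable_def
    by (intro exI[of _ "\<lambda>x. x"] exI[of _ 0] conjI id)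
      (simp add: True Zero_fract_def eq_fract assms power2_eq_square)
  moreover have "rationalizable (Fract (1 :: ('n, 'k) mpoly) 1)" unfolding rationalizable_def
    by (intro exI[of _ "\<lambda>x. x"] exI[of _ 1] conjI id) (simp flip: One_fract_def)
  moreover have "squarefree (1 :: ('n, 'k) mpoly)"
    unfolding squarefree_def power2_eq_square by (blast intro: dvd_mult_left)
  ultimately show ?thesis by blast
next
  case False
  then obtain s f where f: "p * q = s\<^sup>2 * f" "s \<noteq> 0" "squarefree f"
    using ex_square_times_squarefree[of "p * q"] assms by auto
  have "Fract p q = Fract f 1 * (Fract s q)\<^sup>2"
    using f(1) assms by (simp add: power2_eq_square eq_fract mult.assoc)
  moreover have "Fract s q \<noteq> 0" using f(2) assms by (simp add: Zero_fract_def eq_fract)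
  ultimately show ?thesis using rationalizable_times_square f(3) by metis
qed

abbreviation scalar :: "'k::field \<Rightarrow> ('n::linorder, 'k) mpoly fract" where
  "scalar c \<equiv> Fract (const c) 1"

lemma unital_hom_scalar: "unital_hom scalar"
  by (rule unital_hom_comp[OF unital_hom_Fract unital_hom_const])

lemma eval_scalar_var: "eval_mpoly scalar (\<lambda>i. Fract (var i) 1) p = Fract p 1"
  using hom_eval_mpoly[OF unital_hom_Fract, of const var p] by (simp add: eval_mpoly_const_var)

text \<open>The injective evaluation at \<open>a\<close> extends to fractions.\<close>

lemma ex_k_algebra_hom:
  fixes a :: "'n::{finite,linorder} \<Rightarrow> ('n, 'k::field) mpoly fract"
  assumes inj: "\<And>p. eval_mpoly scalar a p = 0 \<Longrightarrow> p = 0"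
  shows "\<exists>\<phi>. k_algebra_hom \<phi> \<and> (\<forall>p. \<phi> (Fract p 1) = eval_mpoly scalar a p)"
proof -
  let ?e = "eval_mpoly scalar a"
  note e = unital_hom_simps[OF unital_hom_eval[OF unital_hom_scalar]]
  define \<phi> where "\<phi> x = (let (p, q) = SOME (p, q). q \<noteq> 0 \<and> x = Fract p q in ?e p / ?e q)" for x
  have \<phi>: "\<phi> (Fract p q) = ?e p / ?e q" if "q \<noteq> 0" for p q
  proof -
    obtain p' q' where *: "(SOME (p', q'). q' \<noteq> 0 \<and> Fract p q = Fract p' q') = (p', q')"
      by (rule prod.exhaust)
    have "(\<lambda>(p', q'). q' \<noteq> 0 \<and> Fract p q = Fract p' q') (p', q')"
      unfolding *[symmetric] by (rule someI[of _ "(p, q)"]) (simp add: that)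
    then have "q' \<noteq> 0" "p * q' = p' * q" using eq_fract(1)[OF that, of q' p p'] by simp_all
    then have "?e q' \<noteq> 0" "?e q \<noteq> 0" "?e p * ?e q' = ?e p' * ?e q"
      using inj that by (blast, blast, metis e(3))
    then show ?thesis by (simp add: \<phi>_def * field_simps)
  qed
  have nz: "?e q \<noteq> 0" if "q \<noteq> 0" for q using inj that by blast
  have one: "\<phi> (Fract p 1) = ?e p" for p by (simp add: \<phi> e)
  have "\<phi> (x + y) = \<phi> x + \<phi> y \<and> \<phi> (x * y) = \<phi> x * \<phi> y" for x y
  proof (cases x, cases y)
    fix p q p' q' assume "x = Fract p q" "q \<noteq> 0" "y = Fract p' q'" "q' \<noteq> 0"
    then show ?thesis using nz[of q] nz[of q'] by (simp add: \<phi> e field_simps)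
  qed
  moreover have "\<phi> 1 = 1" using one[of 1] by (simp add: One_fract_def e)
  moreover have "\<phi> (scalar c) = scalar c" for c
    by (simp add: one eval_mpoly_const[OF unital_hom_scalar])
  ultimately show ?thesis using one by (auto simp: k_algebra_hom_def)
qed

text \<open>
  A homomorphism \<open>Q \<rightarrow> Q\<close> is determined by the images of the variables, and it is injective as
  \<open>Q\<close> is a field, so these images are algebraically independent.
\<close>

lemma rationalizable_iff_substitution:
  fixes f :: "('n::{finite,linorder}, 'k::field) mpoly"
  shows "rationalizable (Fract f 1) \<longleftrightarrow>
    (\<exists>(a :: 'n \<Rightarrow> ('n, 'k) mpoly fract) h. (\<forall>p :: ('n, 'k) mpoly. eval_mpoly scalar a p = 0 \<longrightarrow> p = 0) \<and> eval_mpoly scalar a f = h\<^sup>2)"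
    (is "_ \<longleftrightarrow> ?R")
proof
  assume "rationalizable (Fract f 1)"
  then obtain \<phi> h where hom: "k_algebra_hom \<phi>" and h: "\<phi> (Fract f 1) = h\<^sup>2"
    by (auto simp: rationalizable_def)
  note \<phi> = k_algebra_hom_imp_unital_hom[OF hom]
  let ?a = "\<lambda>i. \<phi> (Fract (var i) 1)"
  have e: "eval_mpoly scalar ?a p = \<phi> (Fract p 1)" for p
    using hom_eval_mpoly[OF unital_hom_comp[OF \<phi> unital_hom_Fract], of const var p] hom
    by (simp add: eval_mpoly_const_var k_algebra_hom_def)
  have "\<forall>p :: ('n, 'k) mpoly. eval_mpoly scalar ?a p = 0 \<longrightarrow> p = 0"
    by (simp add: e unital_hom_field_inj[OF \<phi>] Fract_1_eq_0_iff)
  then show ?R by (intro exI[of _ ?a] exI[of _ h]) (simp add: e h)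
next
  assume ?R
  then obtain a :: "'n \<Rightarrow> ('n, 'k) mpoly fract" and h where inj: "\<And>p :: ('n, 'k) mpoly. eval_mpoly scalar a p = 0 \<Longrightarrow> p = 0"
    and h: "eval_mpoly scalar a f = h\<^sup>2" by blast
  obtain \<phi> where "k_algebra_hom \<phi>" "\<And>p. \<phi> (Fract p 1) = eval_mpoly scalar a p"
    using ex_k_algebra_hom[OF inj] by blast
  then show "rationalizable (Fract f 1)"
    unfolding rationalizable_def using h by (intro exI[of _ \<phi>]) auto
qed

(* Otherwise the weights \<lambda>_. 1 of the standard grading are rewritten to \<lambda>_. Suc 0. *)
declare One_nat_def [simp del]

section \<open>Homogenization and dehomogenization\<close>

lemma var_neq_0: "var i \<noteq> (0 :: ('v, 'k::zero_neq_one) mpoly)"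
  unfolding var_def by (metis lookup_single_eq lookup_zero zero_neq_one)

definition dehomogenize :: "('n::finite option, 'k::comm_ring_1) mpoly \<Rightarrow> ('n, 'k) mpoly" where
  "dehomogenize = eval_mpoly const (case_option 1 var)"

lemma unital_hom_dehomogenize: "unital_hom dehomogenize"
  unfolding dehomogenize_def by (rule unital_hom_eval[OF unital_hom_const])

lemma eval_dehomogenize:
  assumes "unital_hom h"
  shows "eval_mpoly h x (dehomogenize P) = eval_mpoly h (case_option 1 x) P"
proof -
  have "(\<lambda>i. eval_mpoly h x (case_option 1 var i)) = case_option 1 x"
    by (simp add: fun_eq_iff eval_mpoly_simps[OF assms] split: option.split)
  then show ?thesis by (simp add: dehomogenize_def eval_mpoly_eval[OF assms])
qed

text \<open>
  In the fraction field, a form is \<open>P(z, x) = z\<^sup>e P(1, x/z)\<close>, so it is determined by its values at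
  \<open>z = 1\<close>.
\<close>

lemma dehomogenize_eq_0:
  fixes P :: "('n::{finite,linorder} option, 'k::field) mpoly"
  assumes P: "homogeneous (\<lambda>_. 1) e P" and 0: "dehomogenize P = 0"
  shows "P = 0"
proof -
  define x where "x i = (Fract (var i) 1 :: ('n option, 'k) mpoly fract)" for i
  let ?y = "\<lambda>i. x (Some i) / x None"
  have nz: "x None \<noteq> 0" by (simp add: x_def Fract_1_eq_0_iff var_neq_0)
  have "Fract P 1 = eval_mpoly scalar x P"
    unfolding x_def by (rule eval_scalar_var[symmetric])
  also have "x = (\<lambda>i. x None ^ 1 * case_option 1 ?y i)"
    using nz by (simp add: fun_eq_iff split: option.split)
  also have "eval_mpoly scalar \<dots> P = x None ^ e * eval_mpoly scalar (case_option 1 ?y) P"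
    by (rule eval_homogeneous_scale[OF P])
  also have "\<dots> = x None ^ e * eval_mpoly scalar ?y (dehomogenize P)"
    by (simp add: eval_dehomogenize[OF unital_hom_scalar])
  also have "\<dots> = 0"
    by (simp add: 0 eval_mpoly_simps[OF unital_hom_scalar])
  finally show ?thesis by (simp add: Fract_1_eq_0_iff)
qed

lemma eval_homogenize:
  assumes "unital_hom h"
  shows "eval_mpoly h x (homogenize E p) =
    (\<Sum>m\<in>Poly_Mapping.keys p. h (Poly_Mapping.lookup p m) * x (Some None) ^ (E - mdeg m) *
       (\<Prod>i\<in>UNIV. x (Some (Some i)) ^ Poly_Mapping.lookup m i))"
  by (simp add: homogenize_def eval_mpoly_simps[OF assms])

lemma eval_homogenize_affine:
  assumes "unital_hom h" "x (Some None) = 1"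
  shows "eval_mpoly h x (homogenize E p) = eval_mpoly h (\<lambda>i. x (Some (Some i))) p"
  unfolding eval_homogenize[OF assms(1)] by (simp add: assms(2) eval_mpoly_def)

lemma mdeg_le_tdegree: "m \<in> Poly_Mapping.keys p \<Longrightarrow> mdeg m \<le> tdegree p"
  unfolding tdegree_def by (rule Max_ge) auto

lemma homogeneous_homogenize:
  fixes p :: "('n::finite, 'k::field) mpoly"
  assumes "tdegree p \<le> E" and a: "\<And>i. a (Some i) = 1"
  shows "homogeneous a E (homogenize E p)"
  unfolding homogenize_def
proof (rule homogeneous_sum)
  fix m assume "m \<in> Poly_Mapping.keys p"
  then have "mdeg m \<le> E" using mdeg_le_tdegree assms(1) le_trans by blast
  then have E: "0 + (E - mdeg m) * a (Some None) + (\<Sum>i\<in>UNIV. Poly_Mapping.lookup m i * a (Some (Some i))) = E"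
    by (simp add: a wdeg_def)
  have "homogeneous a (0 + (E - mdeg m) * a (Some None) + (\<Sum>i\<in>UNIV. Poly_Mapping.lookup m i * a (Some (Some i))))
     (const (Poly_Mapping.lookup p m) * var (Some None) ^ (E - mdeg m) *
       (\<Prod>i\<in>UNIV. var (Some (Some i)) ^ Poly_Mapping.lookup m i))"
    by (intro homogeneous_mult homogeneous_const homogeneous_prod homogeneous_power homogeneous_var)
  then show "homogeneous a E
     (const (Poly_Mapping.lookup p m) * var (Some None) ^ (E - mdeg m) *
       (\<Prod>i\<in>UNIV. var (Some (Some i)) ^ Poly_Mapping.lookup m i))"
    unfolding E .
qed

definition embed :: "('n::finite option, 'k::comm_ring_1) mpoly \<Rightarrow> ('n option option, 'k) mpoly" where
  "embed = eval_mpoly const (\<lambda>i. var (Some i))"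

lemma unital_hom_embed: "unital_hom embed"
  unfolding embed_def by (rule unital_hom_eval[OF unital_hom_const])

lemma ex_embed_eq_homogenize:
  fixes p :: "('n::finite, 'k::field) mpoly"
  shows "\<exists>P. embed P = homogenize E p"
proof
  have "embed (eval_mpoly const (case_option 0 var) (homogenize E p)) =
      eval_mpoly const var (homogenize E p)"
    unfolding embed_def eval_mpoly_eval[OF unital_hom_const] eval_homogenize[OF unital_hom_const]
    by (simp add: eval_mpoly_simps[OF unital_hom_const])
  then show "embed (eval_mpoly const (case_option 0 var) (homogenize E p)) = homogenize E p"
    by (simp add: eval_mpoly_const_var)
qed

lemma ex_homogenization:
  fixes p :: "('n::finite, 'k::field) mpoly"
  assumes "tdegree p \<le> E"
  shows "\<exists>P. homogeneous (\<lambda>_. 1) E P \<and> dehomogenize P = p"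
proof (intro exI conjI)
  let ?P = "eval_mpoly const (case_option 0 var) (homogenize E p)"
  have "homogeneous (\<lambda>_. 1) (1 * E) ?P"
    by (rule homogeneous_eval[OF homogeneous_homogenize[OF assms, of "\<lambda>_. 1"]])
      (auto split: option.split intro: homogeneous_var[where a = "\<lambda>_. 1", simplified])
  then show "homogeneous (\<lambda>_. 1) E ?P" by simp
  have "dehomogenize ?P = eval_mpoly const var p"
    unfolding dehomogenize_def eval_mpoly_eval[OF unital_hom_const]
    by (subst eval_homogenize_affine) (simp_all add: unital_hom_const eval_mpoly_simps[OF unital_hom_const])
  then show "dehomogenize ?P = p" by (simp add: eval_mpoly_const_var)
qed

section \<open>Divisibility by a coordinate\<close>

text \<open>Setting a variable to 0 is the reduction modulo this variable, so divisibility by it can be tested by evaluation.\<close>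

lemma var_dvd_diff_eval:
  fixes p :: "('v::finite, 'k::comm_ring_1) mpoly"
  shows "var i dvd p - eval_mpoly const (var(i := 0)) p"
proof -
  define y :: "'v \<Rightarrow> ('v, 'k) mpoly" where "y = var(i := 0)"
  have y: "var i dvd var k - y k" for k by (simp add: y_def)
  have "var i dvd p - eval_mpoly const y p"
  proof (induction p rule: mpoly_induct)
    case (add p q)
    then have "var i dvd (p - eval_mpoly const y p) + (q - eval_mpoly const y q)"
      by (rule dvd_add)
    then show ?case by (simp add: eval_mpoly_simps[OF unital_hom_const] algebra_simps)
  next
    case (mult p q)
    then have "var i dvd (p - eval_mpoly const y p) * q + eval_mpoly const y p * (q - eval_mpoly const y q)"
      by (intro dvd_add dvd_mult dvd_mult2)
    then show ?case by (simp add: eval_mpoly_simps[OF unital_hom_const] algebra_simps)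
  qed (simp_all add: eval_mpoly_simps[OF unital_hom_const] y)
  then show ?thesis by (simp add: y_def)
qed

lemma var_dvd_iff:
  fixes p :: "('v::finite, 'k::comm_ring_1) mpoly"
  shows "var i dvd p \<longleftrightarrow> eval_mpoly const (var(i := 0)) p = 0"
proof
  assume "var i dvd p"
  then show "eval_mpoly const (var(i := 0)) p = 0"
    by (auto simp: eval_mpoly_simps[OF unital_hom_const] elim!: dvdE)
next
  assume "eval_mpoly const (var(i := 0)) p = 0"
  then show "var i dvd p" using var_dvd_diff_eval[of i p] by simp
qed

text \<open>
  Variables are prime, since the ring obtained by setting one of them to 0 has no zero divisors.  Hence
  the powers of a variable that does not divide \<open>F\<close> can be cancelled.
\<close>

lemma dvd_of_var_power_mult_eq:
  fixes F G H :: "('v::{finite,linorder}, 'k::field) mpoly"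
  assumes "\<not> var i dvd F" "var i ^ N * G = F * H"
  shows "F dvd G"
  using assms(2)
proof (induction N arbitrary: H)
  case (Suc N)
  then have eq: "var i * (var i ^ N * G) = F * H" by (simp add: mult.assoc)
  then have "var i dvd F * H" by (metis dvd_triv_left)
  then have "var i dvd H"
    using assms(1) by (simp add: var_dvd_iff eval_mpoly_simps[OF unital_hom_const])
  then obtain H' where "H = var i * H'" by (elim dvdE)
  then have "var i * (var i ^ N * G) = var i * (F * H')" using eq by (simp add: mult.left_commute)
  then have "var i ^ N * G = F * H'" by (simp only: mult_left_cancel[OF var_neq_0])
  then show ?case by (rule Suc.IH)
qed simp

section \<open>Hypersurfaces quadratic in one coordinate\<close>

definition affine_point :: "('n \<Rightarrow> 'r) \<Rightarrow> 'r \<Rightarrow> 'n option option \<Rightarrow> 'r::comm_ring_1" where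
  "affine_point a h = case_option h (case_option 1 a)"

lemma affine_point_simps [simp]:
  "affine_point a h None = h" "affine_point a h (Some None) = 1" "affine_point a h (Some (Some i)) = a i"
  by (simp_all add: affine_point_def)

text \<open>
  The hypersurface \<open>z\<^sup>j w\<^sup>2 = z\<^sup>D f(x/z)\<close> with \<open>D = j + 2r\<close>, where \<open>w\<close> has weight \<open>r\<close>.  The projective
  closure of \<open>W\<^sup>2 = f\<close> is the case \<open>r = 1\<close> and the double cover is the case \<open>j = 0\<close>.  Under the
  last assumption \<open>z\<close> does not divide the equation, that is, no component lies at infinity.
\<close>

locale quadratic_hypersurface =
  fixes f :: "('n::{finite,linorder}, 'k::field) mpoly" and r j :: nat
  assumes r_pos: "r > 0" and tdegree_le: "tdegree f \<le> j + 2 * r"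
    and no_z_factor: "j = 0 \<or> tdegree f = j + 2 * r"
begin

definition wt :: "'n option option \<Rightarrow> nat" where
  "wt i = (if i = None then r else 1)"

lemma wt_simps [simp]: "wt None = r" "wt (Some i) = 1"
  by (simp_all add: wt_def)

definition equation :: "('n option option, 'k) mpoly" where
  "equation = var (Some None) ^ j * (var None)\<^sup>2 - homogenize (j + 2 * r) f"

lemma eval_equation:
  "unital_hom h \<Longrightarrow> eval_mpoly h x equation =
     x (Some None) ^ j * (x None)\<^sup>2 - eval_mpoly h x (homogenize (j + 2 * r) f)"
  by (simp add: equation_def eval_mpoly_simps)

lemma eval_equation_affine:
  "unital_hom h \<Longrightarrow> eval_mpoly h (affine_point a b) equation = b\<^sup>2 - eval_mpoly h a f"
  by (simp add: eval_equation eval_homogenize_affine)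

lemma homogeneous_equation: "homogeneous wt (j + 2 * r) equation"
proof -
  have "homogeneous wt (j * wt (Some None) + 2 * wt None) (var (Some None) ^ j * (var None)\<^sup>2 :: ('n option option, 'k) mpoly)"
    by (intro homogeneous_mult homogeneous_power homogeneous_var)
  then show ?thesis
    unfolding equation_def using homogeneous_homogenize[OF tdegree_le, of wt]
    by (intro homogeneous_diff) simp_all
qed

text \<open>
  A point with \<open>z = 0\<close> where the equation does not vanish: \<open>w = 1, x = 0\<close> if \<open>j = 0\<close>, and
  otherwise \<open>w = 0\<close> and generic \<open>x\<close>, where the equation reduces to the leading form of \<open>f\<close>.
\<close>

lemma not_var_dvd_equation: "\<not> var (Some None) dvd equation"
proof
  assume "var (Some None) dvd equation"
  then obtain Q where Q: "equation = var (Some None) * Q" by (elim dvdE)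
  have ev0: "eval_mpoly h x equation = 0" if "unital_hom h" "x (Some None) = 0"
    for h :: "'k \<Rightarrow> ('n, 'k) mpoly" and x
    by (simp add: Q eval_mpoly_simps that)
  show False
  proof (cases "j = 0")
    case True
    let ?x = "case_option 1 (\<lambda>_. 0) :: 'n option option \<Rightarrow> ('n, 'k) mpoly"
    have "eval_mpoly const ?x (homogenize (j + 2 * r) f) = 0"
      unfolding eval_homogenize[OF unital_hom_const]
    proof (rule sum.neutral, intro ballI)
      fix m assume "m \<in> Poly_Mapping.keys f"
      show "const (Poly_Mapping.lookup f m) * ?x (Some None) ^ (j + 2 * r - mdeg m) *
         (\<Prod>i\<in>UNIV. ?x (Some (Some i)) ^ Poly_Mapping.lookup m i) = 0"
      proof (cases "\<exists>i. Poly_Mapping.lookup m i \<noteq> 0")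
        case True
        then have "(\<Prod>i\<in>UNIV. ?x (Some (Some i)) ^ Poly_Mapping.lookup m i) = 0"
          by (intro prod_zero) auto
        then show ?thesis by simp
      next
        case False
        then have "mdeg m = 0" by (simp add: wdeg_def)
        then show ?thesis using r_pos by simp
      qed
    qed
    then show False
      using ev0[OF unital_hom_const, of ?x] eval_equation[OF unital_hom_const, of ?x] by (simp add: True)
  next
    case False
    then have d: "tdegree f = j + 2 * r" using no_z_factor by blast
    let ?x = "case_option 0 (case_option 0 var) :: 'n option option \<Rightarrow> ('n, 'k) mpoly"
    have "tdegree f \<in> insert 0 (mdeg ` Poly_Mapping.keys f)"
      unfolding tdegree_def by (rule Max_in) auto
    then obtain m0 where m0: "m0 \<in> Poly_Mapping.keys f" "mdeg m0 = j + 2 * r"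
      using d r_pos by auto
    have "eval_mpoly const ?x (homogenize (j + 2 * r) f) =
        (\<Sum>m\<in>Poly_Mapping.keys f. if mdeg m = j + 2 * r then Poly_Mapping.single m (Poly_Mapping.lookup f m) else 0)"
      unfolding eval_homogenize[OF unital_hom_const]
    proof (rule sum.cong)
      fix m assume "m \<in> Poly_Mapping.keys f"
      then have "mdeg m \<le> j + 2 * r" using mdeg_le_tdegree tdegree_le le_trans by blast
      moreover have "(\<Prod>i\<in>UNIV. var i ^ Poly_Mapping.lookup m i) = (Poly_Mapping.single m 1 :: ('n, 'k) mpoly)"
        using monomial_value_var[of m] by (simp add: monomial_value_def)
      ultimately show "const (Poly_Mapping.lookup f m) * ?x (Some None) ^ (j + 2 * r - mdeg m) *
         (\<Prod>i\<in>UNIV. ?x (Some (Some i)) ^ Poly_Mapping.lookup m i) =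
         (if mdeg m = j + 2 * r then Poly_Mapping.single m (Poly_Mapping.lookup f m) else 0)"
        by (auto simp: const_def mult_single power_0_left)
    qed simp
    then have "Poly_Mapping.lookup (eval_mpoly const ?x (homogenize (j + 2 * r) f)) m0 =
        (\<Sum>m\<in>Poly_Mapping.keys f. if m = m0 then Poly_Mapping.lookup f m0 else 0)"
      by (simp only: lookup_sum) (rule sum.cong, auto simp: lookup_single when_def m0)
    also have "\<dots> \<noteq> 0" using m0 by (simp add: in_keys_iff)
    finally show False
      using ev0[OF unital_hom_const, of ?x] by (auto simp: eval_equation[OF unital_hom_const])
  qed
qed

text \<open>
  Up to powers of \<open>z\<close>, the equation expresses \<open>w\<^sup>2\<close> through \<open>z\<close> and \<open>x\<close>, so every polynomial has a
  remainder of degree at most 1 in \<open>w\<close>.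
\<close>

lemma pseudo_division:
  "\<exists>N H A B. var (Some None) ^ N * G = equation * H + embed A + embed B * var None"
proof (induction G rule: mpoly_induct)
  case (const c)
  have "var (Some None) ^ 0 * const c = equation * 0 + embed (const c) + embed 0 * var None"
    unfolding embed_def by (simp add: eval_mpoly_simps[OF unital_hom_const])
  then show ?case by fast
next
  case (var i)
  show ?case
  proof (cases i)
    case None
    have "var (Some None) ^ 0 * var i = equation * 0 + embed 0 + embed 1 * var None"
      unfolding embed_def None by (simp add: eval_mpoly_simps[OF unital_hom_const])
    then show ?thesis by fast
  next
    case (Some i')
    have "var (Some None) ^ 0 * var i = equation * 0 + embed (var i') + embed 0 * var None"
      unfolding embed_def Some by (simp add: eval_mpoly_simps[OF unital_hom_const])
    then show ?thesis by fast
  qed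
next
  case (add p q)
  let ?z = "var (Some None) :: ('n option option, 'k) mpoly"
  have z: "embed (var None ^ n) = ?z ^ n" for n
    by (simp add: embed_def eval_mpoly_simps[OF unital_hom_const])
  obtain N H A B where p: "?z ^ N * p = equation * H + embed A + embed B * var None" using add(1) by blast
  obtain N' H' A' B' where q: "?z ^ N' * q = equation * H' + embed A' + embed B' * var None" using add(2) by blast
  have "?z ^ (N + N') * (p + q) = ?z ^ N' * (?z ^ N * p) + ?z ^ N * (?z ^ N' * q)"
    by (simp add: power_add algebra_simps)
  also have "\<dots> = equation * (?z ^ N' * H + ?z ^ N * H') + embed (var None ^ N' * A + var None ^ N * A')
      + embed (var None ^ N' * B + var None ^ N * B') * var None"
    unfolding p q by (simp add: unital_hom_add[OF unital_hom_embed] unital_hom_mult[OF unital_hom_embed] z algebra_simps)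
  finally show ?case by blast
next
  case (mult p q)
  let ?z = "var (Some None) :: ('n option option, 'k) mpoly" and ?w = "var None :: ('n option option, 'k) mpoly"
  have z: "embed (var None ^ n) = ?z ^ n" for n
    by (simp add: embed_def eval_mpoly_simps[OF unital_hom_const])
  obtain C where C: "embed C = homogenize (j + 2 * r) f" using ex_embed_eq_homogenize by blast
  then have w: "?z ^ j * ?w\<^sup>2 = equation + embed C" by (simp add: equation_def)
  obtain N H A B where p: "?z ^ N * p = equation * H + embed A + embed B * ?w" using mult(1) by blast
  obtain N' H' A' B' where q: "?z ^ N' * q = equation * H' + embed A' + embed B' * ?w" using mult(2) by blast
  have "?z ^ (j + N + N') * (p * q) = ?z ^ j * ((?z ^ N * p) * (?z ^ N' * q))"
    by (simp add: power_add algebra_simps)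
  also have "\<dots> = equation * (?z ^ j * (H * (equation * H' + embed A' + embed B' * ?w) + (embed A + embed B * ?w) * H'))
      + ?z ^ j * embed A * embed A' + ?z ^ j * (embed A * embed B' + embed B * embed A') * ?w
      + embed B * embed B' * (?z ^ j * ?w\<^sup>2)"
    unfolding p q by (simp add: algebra_simps power2_eq_square)
  also have "\<dots> = equation * (?z ^ j * (H * (equation * H' + embed A' + embed B' * ?w) + (embed A + embed B * ?w) * H')
        + embed B * embed B')
      + embed (var None ^ j * (A * A') + B * B' * C)
      + embed (var None ^ j * (A * B' + B * A')) * ?w"
    unfolding w by (simp add: unital_hom_add[OF unital_hom_embed] unital_hom_mult[OF unital_hom_embed] z algebra_simps)
  finally show ?case by blast
qed

text \<open>
  The ring \<open>k[X, W]/(W\<^sup>2 - f)\<close> has the basis \<open>1, W\<close> over \<open>k[X]\<close>.  A generic root is a point \<open>(a, h)\<close> at which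
  this ring is evaluated injectively.
\<close>

definition generic_root :: "('k \<Rightarrow> 'r::comm_ring_1) \<Rightarrow> ('n \<Rightarrow> 'r) \<Rightarrow> 'r \<Rightarrow> bool" where
  "generic_root \<iota> a h \<longleftrightarrow> unital_hom \<iota> \<and> eval_mpoly \<iota> a f = h\<^sup>2 \<and>
     (\<forall>A B. eval_mpoly \<iota> a A + eval_mpoly \<iota> a B * h = 0 \<longrightarrow> A = 0 \<and> B = 0)"

text \<open>
  The homogeneous ideal of a generic root is generated by the equation.  Indeed, the remainder of a
  pseudo-division vanishes at the root, componentwise after the evaluation at
  \<open>(t\<^sup>r h, t, t a)\<close>, so it is zero by genericity.
\<close>

lemma equation_dvd:
  assumes root: "generic_root \<iota> a h"
    and G: "\<And>e. eval_mpoly \<iota> (affine_point a h) (hom_component wt e G) = 0"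
  shows "equation dvd G"
proof -
  have \<iota>: "unital_hom \<iota>" and f: "eval_mpoly \<iota> a f = h\<^sup>2"
    and indep: "\<And>A B. eval_mpoly \<iota> a A + eval_mpoly \<iota> a B * h = 0 \<Longrightarrow> A = 0 \<and> B = 0"
    using root by (auto simp: generic_root_def)
  let ?\<theta> = "graded_eval wt \<iota> (affine_point a h)"
  note \<theta> = unital_hom_simps[OF unital_hom_graded_eval[OF \<iota>]]
  obtain N H A B where eq: "var (Some None) ^ N * G = equation * H + embed A + embed B * var None"
    using pseudo_division by blast
  \<comment> \<open>Only the remainder of the pseudo-division survives the evaluation.\<close>
  have "?\<theta> G = 0" by (rule poly_eqI) (simp add: coeff_graded_eval G)
  moreover have "?\<theta> equation = 0"
    by (rule poly_eqI) (simp add: coeff_graded_eval hom_component_homogeneous[OF homogeneous_equation]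
        eval_equation_affine[OF \<iota>] f eval_mpoly_simps[OF \<iota>])
  moreover have "?\<theta> (var None) = Polynomial.monom h r"
    by (simp add: graded_eval_def eval_mpoly_var[OF unital_hom_const_poly[OF \<iota>]])
  ultimately have 0: "?\<theta> (embed A) + ?\<theta> (embed B) * Polynomial.monom h r = 0"
    using arg_cong[OF eq, of ?\<theta>] by (simp add: \<theta>)
  have ext: "poly.coeff (?\<theta> (embed C)) e = eval_mpoly \<iota> a (dehomogenize (hom_component (\<lambda>_. 1) e C))" for C e
  proof -
    have "?\<theta> (embed C) = graded_eval (\<lambda>_. 1) \<iota> (case_option 1 a) C"
      unfolding graded_eval_def embed_def eval_mpoly_eval[OF unital_hom_const_poly[OF \<iota>]]
      by (rule arg_cong2[where f = "eval_mpoly _"])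
        (auto simp: eval_mpoly_var[OF unital_hom_const_poly[OF \<iota>]] affine_point_def fun_eq_iff)
    then show ?thesis by (simp add: coeff_graded_eval eval_dehomogenize[OF \<iota>])
  qed
  have 1: "dehomogenize (hom_component (\<lambda>_. 1) e A) = 0" and 2: "dehomogenize (hom_component (\<lambda>_. 1) e B) = 0" for e
  proof -
    have c: "poly.coeff (?\<theta> (embed A)) e + (if r \<le> e then poly.coeff (?\<theta> (embed B)) (e - r) * h else 0) = 0" for e
      using arg_cong[OF 0, of "\<lambda>p. poly.coeff p e"] by (auto simp: coeff_monom_mult mult.commute split: if_splits)
    show "dehomogenize (hom_component (\<lambda>_. 1) e A) = 0"
      using c[of e] indep[of "dehomogenize (hom_component (\<lambda>_. 1) e A)" 0]
        indep[of "dehomogenize (hom_component (\<lambda>_. 1) e A)" "dehomogenize (hom_component (\<lambda>_. 1) (e - r) B)"]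
      by (auto simp: ext eval_mpoly_simps[OF \<iota>] split: if_splits)
    show "dehomogenize (hom_component (\<lambda>_. 1) e B) = 0"
      using c[of "e + r"] indep[of "dehomogenize (hom_component (\<lambda>_. 1) (e + r) A)" "dehomogenize (hom_component (\<lambda>_. 1) e B)"]
      by (auto simp: ext)
  qed
  have "A = 0" "B = 0"
    by (rule mpoly_eq_0_by_components[of "\<lambda>_. 1"], rule dehomogenize_eq_0[OF homogeneous_hom_component], rule 1 2)+
  then have "var (Some None) ^ N * G = equation * H"
    using eq by (simp add: unital_hom_simps[OF unital_hom_embed])
  then show ?thesis by (rule dvd_of_var_power_mult_eq[OF not_var_dvd_equation])
qed

text \<open>A relation \<open>A(a) + B(a) h = 0\<close> with \<open>B \<noteq> 0\<close> would make \<open>f = (A/B)\<^sup>2\<close> a square of a fraction.\<close>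

lemma generic_rootI:
  fixes \<iota> :: "'k \<Rightarrow> 'r::idom"
  assumes "squarefree f" "\<forall>c. f \<noteq> const c" and \<iota>: "unital_hom \<iota>"
    and inj: "\<And>p. eval_mpoly \<iota> a p = 0 \<Longrightarrow> p = 0" and f: "eval_mpoly \<iota> a f = h\<^sup>2"
  shows "generic_root \<iota> a h"
  unfolding generic_root_def
proof (intro conjI allI impI \<iota> f)
  note e = eval_mpoly_simps[OF \<iota>]
  fix A B assume 0: "eval_mpoly \<iota> a A + eval_mpoly \<iota> a B * h = 0"
  show "B = 0"
  proof (rule ccontr)
    assume "B \<noteq> 0"
    have "eval_mpoly \<iota> a A = - (eval_mpoly \<iota> a B * h)" using 0 by (simp add: eq_neg_iff_add_eq_0)
    then have "eval_mpoly \<iota> a (A\<^sup>2 - f * B\<^sup>2) = 0" by (simp add: e f power_mult_distrib)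
    then have "A\<^sup>2 = f * B\<^sup>2" using inj[of "A\<^sup>2 - f * B\<^sup>2"] by simp
    then have "f dvd 1" using squarefree_ratio_of_squares assms(1) \<open>B \<noteq> 0\<close> by blast
    then show False using is_unit_mpoly_imp_const assms(2) by blast
  qed
  then show "A = 0" using 0 inj[of A] by (simp add: e)
qed

end

section \<open>Points of weighted projective space\<close>

lemma primeideal_kernel:
  fixes \<theta> :: "'a::comm_ring_1 \<Rightarrow> 'b::idom"
  assumes "unital_hom \<theta>"
  shows "primeideal {x. \<theta> x = 0} ring_of_type_algebra"
proof -
  note \<theta> = unital_hom_simps[OF assms]
  let ?R = "ring_of_type_algebra :: 'a ring"
  have "ideal {x. \<theta> x = 0} ?R"
  proof (rule idealI)
    show "ring ?R" by (rule ring_from_type_algebra)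
    show "subgroup {x. \<theta> x = 0} (add_monoid ?R)"
    proof (rule subgroup.intro)
      fix x assume "x \<in> {x. \<theta> x = 0}"
      moreover have "inv\<^bsub>add_monoid ?R\<^esub> x = - x"
        by (rule group.inv_equality[OF abelian_group.a_group])
          (auto simp: ring_of_type_algebra_def intro!: ring.is_abelian_group ring_from_type_algebra[unfolded ring_of_type_algebra_def])
      ultimately show "inv\<^bsub>add_monoid ?R\<^esub> x \<in> {x. \<theta> x = 0}" by (simp add: \<theta>)
    qed (auto simp: ring_of_type_algebra_def \<theta>)
  qed (auto simp: ring_of_type_algebra_def \<theta>)
  then show ?thesis
  proof (rule primeidealI)
    show "cring ?R" by (rule cring_from_type_algebra)
    have "1 \<notin> {x. \<theta> x = 0}" by (simp add: \<theta>)
    then show "carrier ?R \<noteq> {x. \<theta> x = 0}" by (auto simp: ring_of_type_algebra_def)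
  qed (auto simp: ring_of_type_algebra_def \<theta>)
qed

lemma Proj_D:
  assumes "P \<in> Proj a"
  shows "0 \<in> P" and "x \<in> P \<Longrightarrow> x * y \<in> P"
proof -
  interpret ideal P ring_of_type_algebra
    using assms by (auto simp: Proj_def intro: primeideal.axioms(1))
  show "0 \<in> P" using additive_subgroup.zero_closed[OF is_additive_subgroup] by (simp add: ring_of_type_algebra_def)
  show "x \<in> P \<Longrightarrow> x * y \<in> P" using I_r_closed[of x y] by (simp add: ring_of_type_algebra_def)
qed

text \<open>
  The largest homogeneous ideal that vanishes at \<open>x\<close>.  For coordinates \<open>x\<close> in an integral domain,
  not all zero, it is the corresponding point of \<^const>\<open>Proj\<close>.
\<close>

definition graded_kernel ::
  "('v::finite \<Rightarrow> nat) \<Rightarrow> ('k::field \<Rightarrow> 'r::comm_ring_1) \<Rightarrow> ('v \<Rightarrow> 'r) \<Rightarrow> ('v, 'k) mpoly set" where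
  "graded_kernel a h x = {G. \<forall>e. eval_mpoly h x (hom_component a e G) = 0}"

lemma homogeneous_in_graded_kernel_iff:
  assumes "unital_hom h" "homogeneous a m G"
  shows "G \<in> graded_kernel a h x \<longleftrightarrow> eval_mpoly h x G = 0"
  by (auto simp: graded_kernel_def hom_component_homogeneous[OF assms(2)] eval_mpoly_simps[OF assms(1)])

text \<open>It is the kernel of \<^const>\<open>graded_eval\<close>, a homomorphism to an integral domain, and therefore prime.\<close>

lemma graded_kernel_in_Proj:
  fixes h :: "'k::field \<Rightarrow> 'r::idom"
  assumes h: "unital_hom h" and i: "x i \<noteq> 0"
  shows "graded_kernel a h x \<in> Proj a"
proof -
  have "graded_kernel a h x = {G. graded_eval a h x G = 0}"
    by (auto simp: graded_kernel_def coeff_graded_eval poly_eq_iff)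
  then have "primeideal (graded_kernel a h x) ring_of_type_algebra"
    using primeideal_kernel[OF unital_hom_graded_eval[OF h]] by simp
  moreover have "hom_component a e p \<in> graded_kernel a h x" if "p \<in> graded_kernel a h x" for p e
    using that by (auto simp: graded_kernel_def hom_component_hom_component eval_mpoly_simps[OF h])
  moreover have "var i \<notin> graded_kernel a h x"
    using i by (simp add: homogeneous_in_graded_kernel_iff[OF h homogeneous_var] eval_mpoly_simps[OF h])
  ultimately show ?thesis by (auto simp: Proj_def)
qed

text \<open>The generic point \<open>{0}\<close> of the source goes to the ideal of the relations among the forms \<open>\<Phi>\<close>.\<close>

lemma image_point_zero: "image_point a \<Phi> {0} = graded_kernel a const \<Phi>"
  by (simp add: image_point_def graded_kernel_def)

lemma zero_in_domain_of_map:
  fixes \<Phi> :: "'v::finite \<Rightarrow> ('u::{finite,linorder}, 'k::field) mpoly"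
  assumes "\<Phi> i \<noteq> 0"
  shows "{0} \<in> domain_of_map \<Phi>"
proof -
  have "primeideal {x :: ('u, 'k) mpoly. x = 0} ring_of_type_algebra"
    by (rule primeideal_kernel) (simp add: unital_hom_def)
  moreover have "hom_component (\<lambda>_. 1) e (0 :: ('u, 'k) mpoly) = 0" for e
    by (rule poly_mapping_eqI) (simp add: lookup_hom_component)
  ultimately have "{0 :: ('u, 'k) mpoly} \<in> Proj (\<lambda>_. 1)"
    by (auto simp: Proj_def var_neq_0)
  then show ?thesis using assms by (auto simp: domain_of_map_def)
qed

section \<open>The Zariski topology\<close>

lemma openin_zariski: "openin (zariski a) {P \<in> Proj a. g \<notin> P}"
  unfolding zariski_def by (rule topology_generated_by_Basis) blast

lemma topspace_zariski: "topspace (zariski a) = Proj a"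
proof
  show "topspace (zariski a) \<subseteq> Proj a" by (auto simp: zariski_def)
  show "Proj a \<subseteq> topspace (zariski a)"
  proof
    fix P assume P: "P \<in> Proj a"
    then obtain i where "var i \<notin> P" by (auto simp: Proj_def)
    then show "P \<in> topspace (zariski a)"
      using P openin_subset[OF openin_zariski[of a "var i"]] by blast
  qed
qed

text \<open>Open sets are stable under passing to smaller primes, so a point specializes to all the points that contain it.\<close>

lemma openin_zariski_generization:
  assumes "openin (zariski a) T" "P \<in> T" "K \<in> Proj a" "K \<subseteq> P"
  shows "K \<in> T"
proof -
  have "generate_topology_on {{P \<in> Proj a. g \<notin> P} | g. True} T"
    using assms(1) by (simp add: zariski_def openin_topology_generated_by_iff)
  then show ?thesis using assms(2)
  proof induction
    case (UN U)
    then show ?case by blast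
  qed (use assms(3,4) in auto)
qed

text \<open>The forms that vanish at \<open>\<Phi>\<close> define closed sets that contain the image.\<close>

lemma closure_of_image_subset:
  assumes "G \<in> graded_kernel a const \<Phi>"
  shows "zariski a closure_of (image_point a \<Phi> ` domain_of_map \<Phi>) \<subseteq> {P \<in> Proj a. G \<in> P}"
proof
  fix P assume P: "P \<in> zariski a closure_of (image_point a \<Phi> ` domain_of_map \<Phi>)"
  then have "P \<in> Proj a" by (simp add: in_closure_of topspace_zariski)
  moreover have "G \<in> P"
  proof (rule ccontr)
    assume "G \<notin> P"
    then have "P \<in> {P \<in> Proj a. G \<notin> P}" using \<open>P \<in> Proj a\<close> by simp
    moreover have "\<forall>T. P \<in> T \<and> openin (zariski a) T \<longrightarrow> (\<exists>y. y \<in> image_point a \<Phi> ` domain_of_map \<Phi> \<and> y \<in> T)"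
      using P unfolding in_closure_of by (rule conjunct2)
    then have "P \<in> {P \<in> Proj a. G \<notin> P} \<and> openin (zariski a) {P \<in> Proj a. G \<notin> P} \<longrightarrow>
        (\<exists>y. y \<in> image_point a \<Phi> ` domain_of_map \<Phi> \<and> y \<in> {P \<in> Proj a. G \<notin> P})"
      by (rule spec)
    ultimately have "\<exists>y. y \<in> image_point a \<Phi> ` domain_of_map \<Phi> \<and> y \<in> {P \<in> Proj a. G \<notin> P}"
      using openin_zariski[of a G] by (simp only: simp_thms)
    then obtain P' where "P' \<in> domain_of_map \<Phi>" "G \<notin> image_point a \<Phi> P'" by blast
    moreover from this(1) have "0 \<in> P'" using Proj_D(1) by (auto simp: domain_of_map_def)
    ultimately show False using assms by (simp add: image_point_def graded_kernel_def)
  qed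
  ultimately show "P \<in> {P \<in> Proj a. G \<in> P}" by simp
qed

section \<open>Rationalizability and unirationality\<close>

lemma common_denominator:
  fixes x :: "'v::finite \<Rightarrow> 'a::idom fract"
  shows "\<exists>b p. b \<noteq> 0 \<and> (\<forall>i. x i = Fract (p i) b)"
proof -
  have "\<forall>i. \<exists>n d. d \<noteq> 0 \<and> x i = Fract n d" by (metis Fract_cases)
  then obtain n d where nd: "\<And>i. d i \<noteq> 0" "\<And>i. x i = Fract (n i) (d i)" by metis
  have "x i = Fract (n i * (\<Prod>j\<in>UNIV - {i}. d j)) (\<Prod>j\<in>UNIV. d j)" for i
  proof -
    have "(\<Prod>j\<in>UNIV. d j) = d i * (\<Prod>j\<in>UNIV - {i}. d j)" by (rule prod.remove) auto
    moreover have "(\<Prod>j\<in>UNIV - {i}. d j) \<noteq> 0" using nd(1) by simp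
    ultimately show ?thesis
      using nd(1)[of i] by (simp only: nd(2) eq_fract mult_eq_0_iff not_False_eq_True simp_thms) (simp only: ac_simps)
  qed
  moreover have "(\<Prod>j\<in>UNIV. d j) \<noteq> 0" using nd(1) by simp
  ultimately show ?thesis
    by (intro exI[of _ "\<Prod>j\<in>UNIV. d j"] exI[of _ "\<lambda>i. n i * (\<Prod>j\<in>UNIV - {i}. d j)"]) simp
qed

context quadratic_hypersurface
begin

text \<open>
  Substituting \<open>\<Phi>\<close> into a form \<open>G\<close> is, up to a power of \<open>b = \<Phi>\<^sub>z\<close>, the evaluation of \<open>G\<close> at the affine
  point with coordinates \<open>\<Phi>\<^sub>x/b\<close> and \<open>\<Phi>\<^sub>w/b\<^sup>r\<close>.  This translates between rational maps and
  substitutions.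
\<close>

lemma dehomogenize_substitution:
  fixes \<Phi> :: "'n option option \<Rightarrow> ('n option, 'k) mpoly"
  defines "b \<equiv> dehomogenize (\<Phi> (Some None))"
  assumes b: "b \<noteq> 0" and G: "homogeneous wt m G"
  shows "Fract (dehomogenize (eval_mpoly const \<Phi> G)) 1 = Fract b 1 ^ m *
    eval_mpoly scalar (affine_point (\<lambda>i. Fract (dehomogenize (\<Phi> (Some (Some i)))) b) (Fract (dehomogenize (\<Phi> None)) (b ^ r))) G"
    (is "_ = _ * eval_mpoly scalar ?x G")
proof -
  let ?\<delta> = "\<lambda>P. Fract (dehomogenize P) 1"
  have \<delta>: "unital_hom ?\<delta>" by (rule unital_hom_comp[OF unital_hom_Fract unital_hom_dehomogenize])
  have \<delta>c: "?\<delta> (const c) = scalar c" for c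
    by (simp add: dehomogenize_def eval_mpoly_const[OF unital_hom_const])
  have bn: "Fract b 1 ^ n = Fract (b ^ n) 1" for n
    by (simp add: unital_hom_power[OF unital_hom_Fract])
  have "?\<delta> (eval_mpoly const \<Phi> G) = eval_mpoly scalar (\<lambda>i. ?\<delta> (\<Phi> i)) G"
    unfolding hom_eval_mpoly[OF \<delta>] \<delta>c ..
  also have "(\<lambda>i. ?\<delta> (\<Phi> i)) = (\<lambda>i. Fract b 1 ^ wt i * ?x i)"
  proof
    fix i show "?\<delta> (\<Phi> i) = Fract b 1 ^ wt i * ?x i"
      using b by (cases i; cases "the i") (auto simp: bn eq_fract b_def[symmetric])
  qed
  also have "eval_mpoly scalar \<dots> G = Fract b 1 ^ m * eval_mpoly scalar ?x G"
    by (rule eval_homogeneous_scale[OF G])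
  finally show ?thesis .
qed

text \<open>
  The image of the generic point is the ideal generated by the equation, so all points of the
  hypersurface are specializations of it.
\<close>

lemma rationalizable_imp_unirational:
  assumes "squarefree f" "\<forall>c. f \<noteq> const c" "rationalizable (Fract f 1)"
  shows "unirational wt (hypersurface wt equation)"
proof -
  obtain a :: "'n \<Rightarrow> ('n, 'k) mpoly fract" and h
    where inj: "\<And>p :: ('n, 'k) mpoly. eval_mpoly scalar a p = 0 \<Longrightarrow> p = 0" and h: "eval_mpoly scalar a f = h\<^sup>2"
    using assms(3) unfolding rationalizable_iff_substitution by blast
  have root: "generic_root scalar a h"
    by (rule generic_rootI[OF assms(1,2) unital_hom_scalar inj h])
  obtain b p where b: "b \<noteq> 0" and p: "\<And>i. case_option h a i = Fract (p i) b"
    using common_denominator[of "case_option h a"] by blast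
  define E where "E = tdegree b + (\<Sum>i\<in>UNIV. tdegree (p i))"
  have "tdegree (p i) \<le> E" for i
    unfolding E_def by (rule trans_le_add2, rule member_le_sum) auto
  then have "\<forall>i. \<exists>P. homogeneous (\<lambda>_. 1) E P \<and> dehomogenize P = p i"
    using ex_homogenization by blast
  then obtain P where P: "\<And>i. homogeneous (\<lambda>_. 1) E (P i)" "\<And>i. dehomogenize (P i) = p i"
    by metis
  have "tdegree b \<le> E" by (simp add: E_def)
  from ex_homogenization[OF this] obtain B where B: "homogeneous (\<lambda>_. 1) E B" "dehomogenize B = b"
    by blast
  \<comment> \<open>The coordinate \<open>h = c/b\<close> has to be written with the denominator \<open>b\<^sup>r\<close>, as \<open>w\<close> has weight \<open>r\<close>.\<close>
  define \<Phi> where "\<Phi> = case_option (P None * B ^ (r - 1)) (case_option B (\<lambda>i. P (Some i)))"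
  have \<Phi>: "homogeneous (\<lambda>_. 1) (E * wt i) (\<Phi> i)" for i
  proof (cases i)
    case None
    have "homogeneous (\<lambda>_. 1) (E + (r - 1) * E) (P None * B ^ (r - 1))"
      by (intro homogeneous_mult homogeneous_power P B)
    also have "E + (r - 1) * E = E * r" using r_pos by (cases r) auto
    finally show ?thesis by (simp add: None \<Phi>_def)
  next
    case (Some i')
    then show ?thesis using P B by (cases i') (auto simp: \<Phi>_def)
  qed
  have pb: "p None * b ^ (r - 1) * b = p None * b ^ r"
    using r_pos by (cases r) auto
  have "Fract (p None * b ^ (r - 1)) (b ^ r) = h"
    using p[of None] b pb by (simp add: eq_fract)
  moreover have "Fract (p (Some i)) b = a i" for i using p[of "Some i"] by simp
  ultimately have x: "affine_point (\<lambda>i. Fract (dehomogenize (\<Phi> (Some (Some i)))) (dehomogenize (\<Phi> (Some None))))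
       (Fract (dehomogenize (\<Phi> None)) (dehomogenize (\<Phi> (Some None)) ^ r)) = affine_point a h"
    by (simp add: \<Phi>_def P B unital_hom_simps[OF unital_hom_dehomogenize])
  have sub: "Fract (dehomogenize (eval_mpoly const \<Phi> G)) 1 = Fract b 1 ^ m * eval_mpoly scalar (affine_point a h) G"
    if "homogeneous wt m G" for G m
    using dehomogenize_substitution[of \<Phi>, OF _ that] b unfolding x by (simp add: \<Phi>_def B)
  have "B \<noteq> 0" using B b by (auto simp: unital_hom_simps[OF unital_hom_dehomogenize])
  then have nz: "\<Phi> (Some None) \<noteq> 0" by (simp add: \<Phi>_def)
  have "eval_mpoly scalar (affine_point a h) equation = 0"
    by (simp add: eval_equation_affine[OF unital_hom_scalar] h)
  then have "dehomogenize (eval_mpoly const \<Phi> equation) = 0"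
    using sub[OF homogeneous_equation] by (simp add: Fract_1_eq_0_iff)
  then have "eval_mpoly const \<Phi> equation = 0"
    using dehomogenize_eq_0[OF homogeneous_eval[OF homogeneous_equation \<Phi>]] by blast
  then have eqK: "equation \<in> graded_kernel wt const \<Phi>"
    by (simp add: homogeneous_in_graded_kernel_iff[OF unital_hom_const homogeneous_equation])
  have K: "graded_kernel wt const \<Phi> \<subseteq> P" if "P \<in> Proj wt" "equation \<in> P" for P
  proof
    fix G assume G: "G \<in> graded_kernel wt const \<Phi>"
    have "equation dvd G"
    proof (rule equation_dvd[OF root])
      fix e
      have "eval_mpoly const \<Phi> (hom_component wt e G) = 0" using G by (simp add: graded_kernel_def)
      then show "eval_mpoly scalar (affine_point a h) (hom_component wt e G) = 0"
        using sub[OF homogeneous_hom_component[of wt e G]] b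
        by (simp add: unital_hom_simps[OF unital_hom_dehomogenize] unital_hom_0[OF unital_hom_Fract] Fract_1_eq_0_iff)
    qed
    then show "G \<in> P" using Proj_D(2)[OF that] by (auto elim: dvdE)
  qed
  have "zariski wt closure_of (image_point wt \<Phi> ` domain_of_map \<Phi>) = hypersurface wt equation"
  proof
    show "zariski wt closure_of (image_point wt \<Phi> ` domain_of_map \<Phi>) \<subseteq> hypersurface wt equation"
      using closure_of_image_subset[OF eqK] by (simp add: hypersurface_def)
    show "hypersurface wt equation \<subseteq> zariski wt closure_of (image_point wt \<Phi> ` domain_of_map \<Phi>)"
    proof
      fix P assume "P \<in> hypersurface wt equation"
      then have P: "P \<in> Proj wt" "equation \<in> P" by (auto simp: hypersurface_def)
      have "graded_kernel wt const \<Phi> \<in> image_point wt \<Phi> ` domain_of_map \<Phi>"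
        unfolding image_point_zero[symmetric] using zero_in_domain_of_map[of \<Phi>, OF nz] by (rule imageI)
      moreover have "graded_kernel wt const \<Phi> \<in> T" if "openin (zariski wt) T" "P \<in> T" for T
        by (rule openin_zariski_generization[OF that _ K[OF P]])
          (rule graded_kernel_in_Proj[of const \<Phi>, OF unital_hom_const nz])
      ultimately show "P \<in> zariski wt closure_of (image_point wt \<Phi> ` domain_of_map \<Phi>)"
        using P(1) unfolding in_closure_of topspace_zariski by (intro conjI allI impI exI) auto
    qed
  qed
  then show ?thesis
    unfolding unirational_def rational_map_def dominant_onto_def using \<Phi> nz by blast
qed

text \<open>
  Density in the form in which it is used: all forms that vanish at \<open>\<Phi>\<close> vanish at a point
  \<open>(h, 1, a)\<close> with algebraically independent \<open>a\<close>.  Neither \<open>z\<close> nor a nonzero homogenized polynomial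
  in \<open>x\<close> vanishes at this point, so they do not vanish at \<open>\<Phi>\<close> either.
\<close>

lemma rationalizable_if_parametrized:
  fixes \<Phi> :: "'n option option \<Rightarrow> ('n option, 'k) mpoly" and \<iota> :: "'k \<Rightarrow> 'r::idom"
  assumes \<Phi>: "\<And>i. homogeneous (\<lambda>_. 1) (E * wt i) (\<Phi> i)"
    and eq: "eval_mpoly const \<Phi> equation = 0"
    and \<iota>: "unital_hom \<iota>" and inj: "\<And>p. eval_mpoly \<iota> a p = 0 \<Longrightarrow> p = 0"
    and dom: "\<And>G m. homogeneous wt m G \<Longrightarrow> eval_mpoly const \<Phi> G = 0 \<Longrightarrow> eval_mpoly \<iota> (affine_point a h) G = 0"
  shows "rationalizable (Fract f 1)"
proof -
  let ?b = "dehomogenize (\<Phi> (Some None))"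
  have "\<Phi> (Some None) \<noteq> 0"
    using dom[OF homogeneous_var[of wt "Some None"]]
    by (auto simp: eval_mpoly_simps[OF \<iota>] eval_mpoly_simps[OF unital_hom_const])
  then have b: "?b \<noteq> 0" using dehomogenize_eq_0[OF \<Phi>] by blast
  let ?a = "\<lambda>i. Fract (dehomogenize (\<Phi> (Some (Some i)))) ?b"
  let ?h = "Fract (dehomogenize (\<Phi> None)) (?b ^ r)"
  note sub = dehomogenize_substitution[of \<Phi>, OF b]
  have "eval_mpoly scalar (affine_point ?a ?h) equation = 0"
    using sub[OF homogeneous_equation] b
    by (simp add: eq unital_hom_simps[OF unital_hom_dehomogenize] Fract_1_eq_0_iff unital_hom_0[OF unital_hom_Fract])
  then have f: "eval_mpoly scalar ?a f = ?h\<^sup>2"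
    by (simp add: eval_equation_affine[OF unital_hom_scalar])
  have "p = 0" if p: "eval_mpoly scalar ?a p = 0" for p :: "('n, 'k) mpoly"
  proof -
    have hom: "homogeneous wt (tdegree p) (homogenize (tdegree p) p)"
      by (rule homogeneous_homogenize) simp_all
    have "eval_mpoly scalar (affine_point ?a ?h) (homogenize (tdegree p) p) = 0"
      by (simp add: eval_homogenize_affine[OF unital_hom_scalar] p)
    then have "dehomogenize (eval_mpoly const \<Phi> (homogenize (tdegree p) p)) = 0"
      using sub[OF hom] by (simp add: Fract_1_eq_0_iff)
    then have "eval_mpoly const \<Phi> (homogenize (tdegree p) p) = 0"
      using dehomogenize_eq_0[OF homogeneous_eval[OF hom \<Phi>]] by blast
    then have "eval_mpoly \<iota> (affine_point a h) (homogenize (tdegree p) p) = 0"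
      by (rule dom[OF hom])
    then show "p = 0"
      using inj by (simp add: eval_homogenize_affine[OF \<iota>])
  qed
  then show ?thesis unfolding rationalizable_iff_substitution using f by blast
qed

text \<open>
  An algebraic closure of \<open>Q\<close> contains a square root of \<open>f\<close>, and so a point of the hypersurface whose
  coordinates \<open>x/z\<close> are the variables.
\<close>

definition closure_scalar :: "'k \<Rightarrow> ('n, 'k) mpoly fract alg_closure" where
  "closure_scalar c = to_ac (scalar c)"

definition closure_var :: "'n \<Rightarrow> ('n, 'k) mpoly fract alg_closure" where
  "closure_var i = to_ac (Fract (var i) 1)"

lemma unital_hom_closure_scalar: "unital_hom closure_scalar"
  unfolding closure_scalar_def by (rule unital_hom_comp[OF unital_hom_to_ac unital_hom_scalar])

lemma eval_closure_var_eq_0: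
  assumes "eval_mpoly closure_scalar closure_var p = 0" shows "p = 0"
proof -
  have "eval_mpoly closure_scalar closure_var p = to_ac (eval_mpoly scalar (\<lambda>i. Fract (var i) 1) p)"
    unfolding hom_eval_mpoly[OF unital_hom_to_ac]
    by (intro arg_cong2[where f = "\<lambda>h x. eval_mpoly h x p"] ext) (rule closure_scalar_def closure_var_def)+
  then have "eval_mpoly closure_scalar closure_var p = to_ac (Fract p 1)"
    by (simp only: eval_scalar_var)
  then show ?thesis
    using assms by (simp add: unital_hom_field_inj[OF unital_hom_to_ac] Fract_1_eq_0_iff)
qed

lemma ex_closure_sqrt: "\<exists>h. eval_mpoly closure_scalar closure_var f = h\<^sup>2"
proof -
  obtain h where "h ^ 2 = eval_mpoly closure_scalar closure_var f"
    using nth_root_exists[of 2 "eval_mpoly closure_scalar closure_var f"] by auto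
  then show ?thesis by (intro exI[of _ h]) simp
qed

text \<open>The point \<open>(\<surd>f, 1, X)\<close> over the algebraic closure lies on the hypersurface, hence in the closure of the image.\<close>

lemma unirational_imp_rationalizable:
  assumes "unirational wt (hypersurface wt equation)"
  shows "rationalizable (Fract f 1)"
proof -
  obtain \<Phi> :: "'n option option \<Rightarrow> ('n option, 'k) mpoly" and E i0
    where \<Phi>: "\<And>i. homogeneous (\<lambda>_. 1) (E * wt i) (\<Phi> i)" and nz: "\<Phi> i0 \<noteq> 0"
      and dom: "zariski wt closure_of (image_point wt \<Phi> ` domain_of_map \<Phi>) = hypersurface wt equation"
    using assms unfolding unirational_def rational_map_def dominant_onto_def by blast
  obtain h where h: "eval_mpoly closure_scalar closure_var f = h\<^sup>2" using ex_closure_sqrt by blast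
  let ?x = "affine_point closure_var h"
  have K: "graded_kernel wt const \<Phi> \<in> Proj wt"
    by (rule graded_kernel_in_Proj[of const \<Phi>, OF unital_hom_const nz])
  moreover have "graded_kernel wt const \<Phi> \<in> image_point wt \<Phi> ` domain_of_map \<Phi>"
    unfolding image_point_zero[symmetric] using zero_in_domain_of_map[of \<Phi>, OF nz] by (rule imageI)
  ultimately have "graded_kernel wt const \<Phi> \<in> hypersurface wt equation"
    unfolding dom[symmetric] in_closure_of topspace_zariski by blast
  then have eq: "eval_mpoly const \<Phi> equation = 0"
    by (simp add: hypersurface_def homogeneous_in_graded_kernel_iff[OF unital_hom_const homogeneous_equation])
  have "graded_kernel wt closure_scalar ?x \<in> Proj wt"
    by (rule graded_kernel_in_Proj[of closure_scalar ?x "Some None", OF unital_hom_closure_scalar]) simp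
  moreover have "equation \<in> graded_kernel wt closure_scalar ?x"
    by (simp add: homogeneous_in_graded_kernel_iff[OF unital_hom_closure_scalar homogeneous_equation]
        eval_equation_affine[OF unital_hom_closure_scalar] h)
  ultimately have gen: "graded_kernel wt closure_scalar ?x \<in> hypersurface wt equation"
    by (simp add: hypersurface_def)
  show ?thesis
  proof (rule rationalizable_if_parametrized[where \<Phi> = \<Phi> and E = E and \<iota> = closure_scalar and a = closure_var and h = h,
        OF \<Phi> eq unital_hom_closure_scalar])
    fix p assume "eval_mpoly closure_scalar closure_var p = 0"
    then show "p = 0" by (rule eval_closure_var_eq_0)
  next
    fix G m assume G: "homogeneous wt m G" "eval_mpoly const \<Phi> G = 0"
    then have "G \<in> graded_kernel wt const \<Phi>"
      by (simp add: homogeneous_in_graded_kernel_iff[OF unital_hom_const])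
    then have "G \<in> graded_kernel wt closure_scalar ?x"
      using subsetD[OF closure_of_image_subset[of G wt \<Phi>, unfolded dom] gen] by simp
    then show "eval_mpoly closure_scalar ?x G = 0"
      by (simp add: homogeneous_in_graded_kernel_iff[OF unital_hom_closure_scalar G(1)])
  qed
qed

end

section \<open>Expansion at a point of large multiplicity\<close>

lemma eval_local_equation:
  assumes h: "unital_hom h" and \<eta>: "\<eta> i = 0"
  shows "eval_mpoly h \<eta> (local_equation F c i) = eval_mpoly h (\<lambda>j. h (c j) + \<eta> j) F"
  unfolding local_equation_def eval_mpoly_eval[OF h]
  by (rule arg_cong[where f = "\<lambda>x. eval_mpoly h x F"]) (auto simp: fun_eq_iff eval_mpoly_simps[OF h] \<eta>)

lemma degree_eval_mpoly_le:
  fixes x :: "'v::finite \<Rightarrow> 'r::comm_ring_1 poly"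
  assumes F: "homogeneous (\<lambda>_. 1) D F" and x: "\<And>i. Polynomial.degree (x i) \<le> 1"
  shows "Polynomial.degree (eval_mpoly (\<lambda>c. [:h c:]) x F) \<le> D"
  unfolding eval_mpoly_def
proof (rule degree_sum_le)
  fix m assume "m \<in> Poly_Mapping.keys F"
  then have D: "mdeg m = D" using F by (simp add: homogeneous_def)
  have "Polynomial.degree (x i ^ n) \<le> n" for i n
    using degree_power_le[of "x i" n] x[of i] by (metis le_trans mult_1 mult_le_mono1)
  then have "Polynomial.degree (\<Prod>i\<in>UNIV. x i ^ Poly_Mapping.lookup m i) \<le> mdeg m"
    using degree_prod_sum_le[of UNIV "\<lambda>i. x i ^ Poly_Mapping.lookup m i"]
    unfolding wdeg_def by (simp add: o_def) (meson le_trans sum_mono)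
  then show "Polynomial.degree ([:h (Poly_Mapping.lookup F m):] * (\<Prod>i\<in>UNIV. x i ^ Poly_Mapping.lookup m i)) \<le> D"
    using degree_mult_le[of "[:h (Poly_Mapping.lookup F m):]" "\<Prod>i\<in>UNIV. x i ^ Poly_Mapping.lookup m i"] D by simp
qed simp

lemma hom_component_local_equation_eq_0:
  fixes F :: "('v::finite, 'k::field) mpoly"
  assumes F: "homogeneous (\<lambda>_. 1) D F" and e: "D < e"
  shows "hom_component (\<lambda>_. 1) e (local_equation F c i) = 0"
proof -
  have h: "unital_hom (\<lambda>c :: 'k. [:const c :: ('v, 'k) mpoly:])"
    by (rule unital_hom_const_poly[OF unital_hom_const])
  have "graded_eval (\<lambda>_. 1) const var (local_equation F c i) =
    eval_mpoly (\<lambda>c. [:const c:]) (\<lambda>j. if j = i then [:const (c j):] else [:const (c j):] + Polynomial.monom (var j) 1) F"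
    unfolding graded_eval_def local_equation_def eval_mpoly_eval[OF h]
    by (rule arg_cong[where f = "\<lambda>x. eval_mpoly _ x F"]) (auto simp: fun_eq_iff eval_mpoly_simps[OF h])
  moreover have "Polynomial.degree (\<dots>) \<le> D"
    by (rule degree_eval_mpoly_le[OF F]) (auto intro!: degree_add_le degree_monom_le)
  ultimately have "poly.coeff (graded_eval (\<lambda>_. 1) const var (local_equation F c i)) e = 0"
    using e by (simp add: coeff_eq_0)
  then show ?thesis by (simp add: coeff_graded_eval eval_mpoly_const_var)
qed

text \<open>
  For a point \<open>c\<close> of multiplicity at least \<open>D - 1\<close>, only the components of degrees \<open>D - 1\<close> and \<open>D\<close> of
  the local equation can be nonzero, and \<open>F(\<eta> + u c) = u\<^sup>D F(c + \<eta>/u)\<close>.  The division by \<open>u\<close> is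
  carried out for an indeterminate in place of \<open>u\<close>, for which the specialization to any \<open>u\<close>, also to
  \<open>u = 0\<close>, is possible.
\<close>

lemma eval_two_components:
  fixes h :: "'k::field \<Rightarrow> 'r::idom"
  assumes F: "homogeneous (\<lambda>_. 1) D F" and D: "D > 0"
    and mult: "\<forall>m\<in>Poly_Mapping.keys (local_equation F c i). D - 1 \<le> mdeg m"
    and h: "unital_hom h" and \<eta>: "\<eta> i = 0"
  shows "eval_mpoly h (\<lambda>j. \<eta> j + u * h (c j)) F =
    eval_mpoly h \<eta> (hom_component (\<lambda>_. 1) D (local_equation F c i)) +
    u * eval_mpoly h \<eta> (hom_component (\<lambda>_. 1) (D - 1) (local_equation F c i))"
proof -
  let ?L = "local_equation F c i"
  let ?A = "hom_component (\<lambda>_. 1) D ?L" and ?B = "hom_component (\<lambda>_. 1) (D - 1) ?L"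
  have L: "?L = ?A + ?B"
  proof (rule poly_mapping_eqI)
    fix m
    have "Poly_Mapping.lookup ?L m = 0" if "D < mdeg m"
      using lookup_hom_component[of "\<lambda>_. 1" "mdeg m" ?L m] hom_component_local_equation_eq_0[OF F that] by simp
    moreover have "Poly_Mapping.lookup ?L m = 0" if "mdeg m < D - 1"
      using mult that by (metis in_keys_iff not_le)
    ultimately show "Poly_Mapping.lookup ?L m = Poly_Mapping.lookup (?A + ?B) m"
      using D by (cases "mdeg m" D rule: linorder_cases) (auto simp: lookup_add lookup_hom_component)
  qed
  have field: "eval_mpoly g (\<lambda>j. \<xi> j + t * g (c j)) F = eval_mpoly g \<xi> ?A + t * eval_mpoly g \<xi> ?B"
    if g: "unital_hom g" and t: "t \<noteq> 0" and \<xi>: "\<xi> i = 0" for g :: "'k \<Rightarrow> 'r poly fract" and t \<xi>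
  proof -
    have "(\<lambda>j. \<xi> j + t * g (c j)) = (\<lambda>j. t ^ 1 * (g (c j) + \<xi> j / t))"
      using t by (simp add: fun_eq_iff field_simps)
    then have "eval_mpoly g (\<lambda>j. \<xi> j + t * g (c j)) F = t ^ D * eval_mpoly g (\<lambda>j. g (c j) + \<xi> j / t) F"
      by (simp only: eval_homogeneous_scale[OF F])
    also have "\<dots> = t ^ D * eval_mpoly g (\<lambda>j. \<xi> j / t) ?L"
      by (subst eval_local_equation[OF g]) (simp_all add: \<xi>)
    also have "\<dots> = t ^ D * eval_mpoly g (\<lambda>j. \<xi> j / t) ?A + t * (t ^ (D - 1) * eval_mpoly g (\<lambda>j. \<xi> j / t) ?B)"
      using D by (subst L) (cases D, simp_all add: eval_mpoly_add[OF g] algebra_simps)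
    also have "\<dots> = eval_mpoly g (\<lambda>j. t ^ 1 * (\<xi> j / t)) ?A + t * eval_mpoly g (\<lambda>j. t ^ 1 * (\<xi> j / t)) ?B"
      by (simp only: eval_homogeneous_scale[OF homogeneous_hom_component])
    finally show ?thesis using t by simp
  qed
  have hp: "unital_hom (\<lambda>c. [:h c:])" by (rule unital_hom_const_poly[OF h])
  have up: "unital_hom (\<lambda>s :: 'r. Fract [:s:] 1)" by (rule unital_hom_comp[OF unital_hom_Fract unital_hom_const_poly_id])
  let ?E = "eval_mpoly (\<lambda>c. [:h c:]) (\<lambda>j. [:\<eta> j, h (c j):]) F"
  have split: "Fract [:p, q:] 1 = Fract [:p:] 1 + Fract [:0, 1:] 1 * Fract [:q:] 1" for p q :: 'r
    by simp
  have "Fract ?E 1 = eval_mpoly (\<lambda>c. Fract [:h c:] 1) (\<lambda>j. Fract [:\<eta> j, h (c j):] 1) F"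
    by (rule hom_eval_mpoly[OF unital_hom_Fract])
  also have "\<dots> = eval_mpoly (\<lambda>c. Fract [:h c:] 1) (\<lambda>j. Fract [:\<eta> j:] 1 + Fract [:0, 1:] 1 * Fract [:h (c j):] 1) F"
    by (subst split) (rule refl)
  also have "\<dots> = eval_mpoly (\<lambda>c. Fract [:h c:] 1) (\<lambda>j. Fract [:\<eta> j:] 1) ?A
      + Fract [:0, 1:] 1 * eval_mpoly (\<lambda>c. Fract [:h c:] 1) (\<lambda>j. Fract [:\<eta> j:] 1) ?B"
    by (rule field[OF unital_hom_comp[OF unital_hom_Fract hp]])
      (simp_all add: Fract_1_eq_0_iff \<eta> unital_hom_0[OF unital_hom_Fract])
  also have "\<dots> = Fract [:eval_mpoly h \<eta> ?A, eval_mpoly h \<eta> ?B:] 1"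
    unfolding split[of "eval_mpoly h \<eta> ?A"] hom_eval_mpoly[OF up] ..
  finally have "?E = [:eval_mpoly h \<eta> ?A, eval_mpoly h \<eta> ?B:]"
    by (simp add: eq_fract)
  then have "poly ?E u = eval_mpoly h \<eta> ?A + u * eval_mpoly h \<eta> ?B" by simp
  moreover have "poly ?E u = eval_mpoly h (\<lambda>j. \<eta> j + u * h (c j)) F"
    unfolding hom_eval_mpoly[OF unital_hom_poly] by simp
  ultimately show ?thesis by simp
qed

text \<open>The local equation at \<open>c\<close> in the chart of the coordinate \<open>i\<close> does not contain the variable \<open>i\<close>.\<close>

lemma eval_hom_component_local_equation:
  fixes F :: "('v::finite, 'k::field) mpoly"
  shows "eval_mpoly const (\<lambda>j. if j = i then 0 else var j) (hom_component (\<lambda>_. 1) e (local_equation F c i)) =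
    hom_component (\<lambda>_. 1) e (local_equation F c i)"
proof -
  let ?L = "local_equation F c i" and ?y = "\<lambda>j. if j = i then 0 else var j :: ('v, 'k) mpoly"
  have h: "unital_hom (\<lambda>c :: 'k. [:const c :: ('v, 'k) mpoly:])"
    by (rule unital_hom_const_poly[OF unital_hom_const])
  have "eval_mpoly const ?y ?L = eval_mpoly const (\<lambda>j. const (c j) + ?y j) F"
    by (rule eval_local_equation[OF unital_hom_const]) simp
  also have "\<dots> = ?L"
    unfolding local_equation_def by (rule arg_cong[where f = "\<lambda>x. eval_mpoly _ x F"]) (auto simp: fun_eq_iff)
  finally have L: "eval_mpoly const ?y ?L = ?L" .
  have "graded_eval (\<lambda>_. 1) const var (eval_mpoly const ?y ?L) = graded_eval (\<lambda>_. 1) const ?y ?L"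
    unfolding graded_eval_def eval_mpoly_eval[OF h]
    by (rule arg_cong[where f = "\<lambda>x. eval_mpoly _ x ?L"]) (auto simp: fun_eq_iff eval_mpoly_simps[OF h])
  then have "poly.coeff (graded_eval (\<lambda>_. 1) const ?y ?L) e = poly.coeff (graded_eval (\<lambda>_. 1) const var ?L) e"
    by (simp only: L)
  then show ?thesis by (simp only: coeff_graded_eval eval_mpoly_const_var)
qed

lemma homogeneous_dvd_imp_eq_0:
  fixes F M :: "('v::{finite,linorder}, 'k::field) mpoly"
  assumes F: "homogeneous a D F" and M: "homogeneous a e M" and "e < D" "F dvd M"
  shows "M = 0"
proof -
  obtain H where H: "M = F * H" using assms(4) by (elim dvdE)
  let ?g = "graded_eval a const var :: ('v, 'k) mpoly \<Rightarrow> _"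
  have "?g F = Polynomial.monom F D"
    by (rule poly_eqI) (simp add: coeff_graded_eval hom_component_homogeneous[OF F] eval_mpoly_const_var)
  then have "?g M = Polynomial.monom F D * ?g H"
    by (simp add: H unital_hom_mult[OF unital_hom_graded_eval[OF unital_hom_const]])
  then have "poly.coeff (?g M) e = 0" using assms(3) by (simp add: coeff_monom_mult)
  then show ?thesis by (simp add: coeff_graded_eval hom_component_homogeneous[OF M] eval_mpoly_const_var)
qed

context quadratic_hypersurface
begin

text \<open>
  The equation on the line through \<open>c\<close> and \<open>\<eta>\<close> is \<open>F(\<eta> + u c) = A(\<eta>) + u B(\<eta>)\<close>, with \<open>B \<noteq> 0\<close> by the
  multiplicity.  So \<open>\<Phi> = B(v) v - A(v) c\<close> with independent variables \<open>v\<close> maps into the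
  hypersurface.  The generic point \<open>(\<surd>f, 1, X)\<close> has the form \<open>\<eta> + u c\<close>, and \<open>\<Phi>\<close> at \<open>v = \<eta>\<close> is
  \<open>B(\<eta>)\<close> times this point, so that forms which vanish at \<open>\<Phi>\<close> vanish there, provided that
  \<open>B(\<eta>) \<noteq> 0\<close>.
\<close>

lemma rationalizable_if_multiplicity:
  assumes r: "r = 1" and f: "squarefree f" "\<forall>c. f \<noteq> const c"
    and ci: "c i \<noteq> 0"
    and mult: "\<forall>m\<in>Poly_Mapping.keys (local_equation equation c i). j + 1 \<le> mdeg m"
    and key: "\<exists>m\<in>Poly_Mapping.keys (local_equation equation c i). mdeg m = j + 1"
  shows "rationalizable (Fract f 1)"
proof -
  have wt: "wt = (\<lambda>_. 1)" unfolding fun_eq_iff wt_def using r by simp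
  have F: "homogeneous (\<lambda>_. 1) (j + 2) equation"
  proof -
    have "j + 2 * r = j + 2" using r by simp
    then show ?thesis using homogeneous_equation unfolding wt by (simp only:)
  qed
  let ?L = "local_equation equation c i"
  define A where "A = hom_component (\<lambda>_. 1) (j + 2) ?L"
  define B where "B = hom_component (\<lambda>_. 1) (j + 1) ?L"
  have hA: "homogeneous (\<lambda>_. 1) (j + 2) A" and hB: "homogeneous (\<lambda>_. 1) (j + 1) B"
    by (simp_all add: A_def B_def homogeneous_hom_component)
  have expand: "eval_mpoly h (\<lambda>l. \<eta> l + u * h (c l)) equation = eval_mpoly h \<eta> A + u * eval_mpoly h \<eta> B"
    if "unital_hom h" "\<eta> i = 0" for h :: "'k \<Rightarrow> 'r::idom" and \<eta> u
  proof -
    have D: "j + 2 - 1 = j + 1" by simp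
    have "\<forall>m\<in>Poly_Mapping.keys ?L. j + 2 - 1 \<le> mdeg m" using mult by (simp only: D)
    moreover have "0 < j + 2" by simp
    ultimately show ?thesis
      unfolding A_def B_def D[symmetric] by (intro eval_two_components F that)
  qed
  have "B \<noteq> 0"
  proof
    assume "B = 0"
    from key obtain m where "m \<in> Poly_Mapping.keys ?L" "mdeg m = j + 1" by blast
    then have "m \<in> Poly_Mapping.keys B" by (simp add: B_def keys_hom_component)
    then show False by (simp add: \<open>B = 0\<close>)
  qed
  obtain h where h: "eval_mpoly closure_scalar closure_var f = h\<^sup>2" using ex_closure_sqrt by blast
  note \<iota> = unital_hom_closure_scalar
  let ?x = "affine_point closure_var h"
  have root: "generic_root closure_scalar closure_var h"
    by (rule generic_rootI[OF f \<iota> eval_closure_var_eq_0 h])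
  have eq_x: "eval_mpoly closure_scalar ?x equation = 0"
    by (simp add: eval_equation_affine[OF \<iota>] h)
  define u where "u = ?x i / closure_scalar (c i)"
  define \<eta> where "\<eta> l = ?x l - u * closure_scalar (c l)" for l
  have "closure_scalar (c i) \<noteq> 0" using ci unital_hom_field_inj[OF \<iota>] by blast
  then have \<eta>i: "\<eta> i = 0" by (simp add: \<eta>_def u_def)
  have x\<eta>: "?x = (\<lambda>l. \<eta> l + u * closure_scalar (c l))" by (simp add: \<eta>_def fun_eq_iff)
  have AB: "eval_mpoly closure_scalar \<eta> A + u * eval_mpoly closure_scalar \<eta> B = 0"
    using eq_x expand[of closure_scalar \<eta> u, OF \<iota> \<eta>i] by (simp only: x\<eta>)
  have nz: "eval_mpoly closure_scalar \<eta> B \<noteq> 0"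
  proof
    assume 0: "eval_mpoly closure_scalar \<eta> B = 0"
    \<comment> \<open>The form \<open>M\<close> is \<open>B\<close> at the projection from \<open>c\<close>.  It would vanish at the generic point, although its degree is smaller than that of the equation.\<close>
    let ?y = "\<lambda>l. var l - var i * const (c l / c i)"
    define M where "M = eval_mpoly const ?y B"
    have hM: "homogeneous wt (j + 1) M"
    proof -
      have "homogeneous wt (1 + 0) (var i * const (c l / c i))" for l
        using homogeneous_var[of wt i] homogeneous_const[of wt "c l / c i"] by (intro homogeneous_mult) (simp_all add: wt)
      then have "homogeneous wt (1 * 1) (?y l)" for l
        using homogeneous_var[of wt l] by (intro homogeneous_diff) (simp_all add: wt)
      then have "homogeneous wt (1 * (j + 1)) M"
        unfolding M_def by (rule homogeneous_eval[OF hB])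
      then show ?thesis by simp
    qed
    have "closure_scalar (c l / c i) * closure_scalar (c i) = closure_scalar (c l)" for l
      using ci by (simp flip: unital_hom_mult[OF \<iota>])
    then have "?x i * closure_scalar (c l / c i) = u * closure_scalar (c l)" for l
      using \<open>closure_scalar (c i) \<noteq> 0\<close> by (simp add: u_def field_simps)
    then have "(\<lambda>l. eval_mpoly closure_scalar ?x (?y l)) = \<eta>"
      by (simp add: fun_eq_iff eval_mpoly_simps[OF \<iota>] \<eta>_def)
    then have "eval_mpoly closure_scalar ?x M = 0"
      by (simp add: M_def eval_mpoly_eval[OF \<iota>] 0)
    then have "equation dvd M"
      by (intro equation_dvd[OF root]) (simp add: hom_component_homogeneous[OF hM] eval_mpoly_simps[OF \<iota>])
    then have "M = 0"
      using homogeneous_dvd_imp_eq_0[OF homogeneous_equation hM] r by simp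
    then have "eval_mpoly const (\<lambda>l. if l = i then 0 else var l) M = 0"
      by (simp add: eval_mpoly_simps[OF unital_hom_const])
    moreover have "eval_mpoly const (\<lambda>l. if l = i then 0 else var l) M = eval_mpoly const (\<lambda>l. if l = i then 0 else var l) B"
      unfolding M_def eval_mpoly_eval[OF unital_hom_const]
      by (rule arg_cong[where f = "\<lambda>x. eval_mpoly _ x B"]) (auto simp: fun_eq_iff eval_mpoly_simps[OF unital_hom_const])
    moreover have "\<dots> = B" unfolding B_def by (rule eval_hom_component_local_equation)
    ultimately show False using \<open>B \<noteq> 0\<close> by simp
  qed
  \<comment> \<open>The coordinates other than \<open>i\<close> are the parameters.\<close>
  have "card (UNIV - {i}) = card (UNIV :: 'n option set)"
  proof -
    have "card (UNIV :: 'n option option set) = Suc (card (UNIV :: 'n option set))"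
      unfolding UNIV_option_conv[where 'a = "'n option"] by (subst card_insert_disjoint) (auto simp: card_image)
    then show ?thesis by (simp add: card_Diff_singleton)
  qed
  then obtain \<sigma> where \<sigma>: "bij_betw \<sigma> (UNIV - {i}) (UNIV :: 'n option set)"
    using finite_same_card_bij[of "UNIV - {i}" "UNIV :: 'n option set"] by auto
  define \<rho> where "\<rho> = inv_into (UNIV - {i}) \<sigma>"
  have \<rho>: "\<rho> (\<sigma> l) = l" if "l \<noteq> i" for l
    unfolding \<rho>_def using bij_betw_inv_into_left[OF \<sigma>] that by simp
  define v :: "'n option option \<Rightarrow> ('n option, 'k) mpoly" where "v l = (if l = i then 0 else var (\<sigma> l))" for l
  define A' where "A' = eval_mpoly const v A"
  define B' where "B' = eval_mpoly const v B"
  define \<Phi> where "\<Phi> l = B' * v l + (- A') * const (c l)" for l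
  have v: "homogeneous (\<lambda>_. 1) (1 * 1) (v l)" for l
    by (cases "l = i") (simp_all add: v_def homogeneous_var[where a = "\<lambda>_. 1"])
  have A': "homogeneous (\<lambda>_. 1) (j + 2) A'" and B': "homogeneous (\<lambda>_. 1) (j + 1) B'"
    using homogeneous_eval[where e = 1 and y = v, OF hA v] homogeneous_eval[where e = 1 and y = v, OF hB v]
    unfolding A'_def B'_def mult_1 by (simp_all only:)
  have \<Phi>: "homogeneous (\<lambda>_. 1) ((j + 2) * wt l) (\<Phi> l)" for l
  proof -
    have "homogeneous (\<lambda>_. 1) (j + 1 + 1 * 1) (B' * v l)" by (intro homogeneous_mult B' v)
    moreover have "homogeneous (\<lambda>_. 1) (j + 2 + 0) (- A' * const (c l))"
      by (intro homogeneous_mult homogeneous_uminus A' homogeneous_const)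
    ultimately show ?thesis unfolding \<Phi>_def wt by (intro homogeneous_add) (simp_all add: One_nat_def)
  qed
  have "eval_mpoly const \<Phi> equation = eval_mpoly const (\<lambda>l. B' ^ 1 * v l) A + (- A') * eval_mpoly const (\<lambda>l. B' ^ 1 * v l) B"
    unfolding \<Phi>_def[abs_def] power_one_right
    by (rule expand[OF unital_hom_const]) (simp add: v_def)
  also have "\<dots> = 0"
    unfolding eval_homogeneous_scale[OF hA] eval_homogeneous_scale[OF hB]
    by (simp add: power_add power2_eq_square flip: A'_def B'_def)
  finally have eq: "eval_mpoly const \<Phi> equation = 0" .
  show ?thesis
  proof (rule rationalizable_if_parametrized[where \<Phi> = \<Phi> and E = "j + 2" and \<iota> = closure_scalar and a = closure_var and h = h,
        OF \<Phi> eq \<iota>])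
    fix p assume "eval_mpoly closure_scalar closure_var p = 0"
    then show "p = 0" by (rule eval_closure_var_eq_0)
  next
    fix G m assume G: "homogeneous wt m G" and 0: "eval_mpoly const \<Phi> G = 0"
    let ?\<mu> = "eval_mpoly closure_scalar (\<lambda>k. \<eta> (\<rho> k))"
    have v\<mu>: "(\<lambda>l. ?\<mu> (v l)) = \<eta>"
      by (auto simp: fun_eq_iff v_def eval_mpoly_simps[OF \<iota>] \<rho> \<eta>i)
    have \<mu>A: "?\<mu> A' = eval_mpoly closure_scalar \<eta> A" and \<mu>B: "?\<mu> B' = eval_mpoly closure_scalar \<eta> B"
      unfolding A'_def B'_def eval_mpoly_eval[OF \<iota>] v\<mu> by (rule refl)+
    have "?\<mu> (\<Phi> l) = eval_mpoly closure_scalar \<eta> B ^ wt l * ?x l" for l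
    proof -
      have "?\<mu> (\<Phi> l) = ?\<mu> B' * \<eta> l - ?\<mu> A' * closure_scalar (c l)"
        using fun_cong[OF v\<mu>, of l] by (simp add: \<Phi>_def eval_mpoly_simps[OF \<iota>])
      also have "?\<mu> A' = - (u * ?\<mu> B')" unfolding \<mu>A \<mu>B using AB by (simp add: eq_neg_iff_add_eq_0)
      finally have "?\<mu> (\<Phi> l) = ?\<mu> B' * (\<eta> l + u * closure_scalar (c l))"
        by (simp only: distrib_left) simp
      then show ?thesis unfolding \<mu>B x\<eta> wt by simp
    qed
    then have "?\<mu> (eval_mpoly const \<Phi> G) = eval_mpoly closure_scalar (\<lambda>l. eval_mpoly closure_scalar \<eta> B ^ wt l * ?x l) G"
      unfolding eval_mpoly_eval[OF \<iota>] by simp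
    also have "\<dots> = eval_mpoly closure_scalar \<eta> B ^ m * eval_mpoly closure_scalar ?x G"
      by (rule eval_homogeneous_scale[OF G])
    finally show "eval_mpoly closure_scalar ?x G = 0"
      using nz by (simp add: 0 eval_mpoly_simps[OF \<iota>])
  qed
qed

end

section \<open>Polynomials of degree at most two\<close>

lemma square_root_from_closedness:
  fixes a :: "'k::field"
  assumes "\<forall>h :: 'k poly. Polynomial.degree h > 0 \<longrightarrow> (\<exists>x. poly h x = 0)"
  shows "\<exists>w. w\<^sup>2 = a"
proof -
  have "Polynomial.degree [:- a, 0, 1:] > 0" by simp
  then obtain x where "poly [:- a, 0, 1:] x = 0" using assms by blast
  then have "x\<^sup>2 = a" by (simp add: power2_eq_square)
  then show ?thesis ..
qed

lemma monomial_split: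
  fixes m :: "'v::finite \<Rightarrow>\<^sub>0 nat"
  assumes "m \<noteq> 0"
  obtains i m' where "m = Poly_Mapping.single i 1 + m'" "mdeg m = 1 + mdeg m'"
proof -
  obtain i where i: "Poly_Mapping.lookup m i \<noteq> 0"
    using assms by (metis lookup_zero poly_mapping_eqI)
  have m: "m = Poly_Mapping.single i 1 + (m - Poly_Mapping.single i 1)"
    by (rule poly_mapping_eqI) (use i in \<open>auto simp: lookup_add lookup_minus lookup_single when_def\<close>)
  have "mdeg m = 1 + mdeg (m - Poly_Mapping.single i 1)"
    using arg_cong[OF m, of mdeg] by (simp only: wdeg_add wdeg_single mult_1)
  with m show ?thesis by (rule that)
qed

lemma mdeg_le_2_cases:
  fixes m :: "'v::finite \<Rightarrow>\<^sub>0 nat"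
  assumes "mdeg m \<le> 2"
  shows "m = 0 \<or> (\<exists>i. m = Poly_Mapping.single i 1) \<or> (\<exists>i l. m = Poly_Mapping.single i 1 + Poly_Mapping.single l 1)"
proof (cases "m = 0")
  case False
  then obtain i m' where m: "m = Poly_Mapping.single i 1 + m'" "mdeg m = 1 + mdeg m'" by (rule monomial_split)
  show ?thesis
  proof (cases "m' = 0")
    case False
    then obtain l m'' where m': "m' = Poly_Mapping.single l 1 + m''" "mdeg m' = 1 + mdeg m''" by (rule monomial_split)
    then have "mdeg m'' = 0" using m assms by simp
    then have "m'' = 0" by (simp only: mdeg_eq_0_iff)
    then show ?thesis using m m' by auto
  qed (use m in auto)
qed simp

lemma sum_squared_char_2:
  fixes g :: "'a \<Rightarrow> 'r::comm_ring_1"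
  assumes "(2 :: 'r) = 0"
  shows "(\<Sum>x\<in>A. g x)\<^sup>2 = (\<Sum>x\<in>A. (g x)\<^sup>2)"
proof -
  have "(x + y)\<^sup>2 = x\<^sup>2 + y\<^sup>2" for x y :: 'r by (simp add: power2_sum assms)
  then show ?thesis by (induction A rule: infinite_finite_induct) simp_all
qed

text \<open>
  If 2 is invertible, all \<open>w i\<close> are zero and \<open>f\<close> is constant.  Otherwise squaring is additive and \<open>f\<close>
  is the square of the linear polynomial with the coefficients \<open>w i\<close> and \<open>w0\<close>.
\<close>

lemma diagonal_quadratic_is_square:
  fixes f :: "('n::{finite,linorder}, 'k::field) mpoly"
  assumes keys: "Poly_Mapping.keys f \<subseteq> insert 0 (range (\<lambda>i. Poly_Mapping.single i 2))"
    and w: "\<And>i. (w i)\<^sup>2 = Poly_Mapping.lookup f (Poly_Mapping.single i 2)" "\<And>i. 2 * w i = 0"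
    and w0: "w0\<^sup>2 = Poly_Mapping.lookup f 0"
  shows "(\<exists>c. f = const c) \<or> (\<exists>g. f = g\<^sup>2)"
proof (cases "(2 :: 'k) = 0")
  case False
  then have "w i = 0" for i using w(2)[of i] by simp
  then have "Poly_Mapping.lookup f (Poly_Mapping.single i 2) = 0" for i using w(1)[of i] by simp
  then have "Poly_Mapping.keys f \<subseteq> {0}" using keys by (auto simp: in_keys_iff)
  then have "f = const (Poly_Mapping.lookup f 0)"
    by (intro poly_mapping_eqI) (auto simp: const_def lookup_single when_def in_keys_iff)
  then show ?thesis by blast
next
  case True
  then have "const (2 :: 'k) = (0 :: ('n, 'k) mpoly)" by (simp add: const_def)
  then have two: "(2 :: ('n, 'k) mpoly) = 0" by (simp add: const_def)
  let ?s = "\<lambda>i :: 'n. Poly_Mapping.single i (2 :: nat)"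
  have "i = l" if "?s i = ?s l" for i l
    using arg_cong[OF that, of "\<lambda>m. Poly_Mapping.lookup m l"] by (simp add: lookup_single when_def split: if_splits)
  then have inj: "inj ?s" by (rule injI)
  have "?s i \<noteq> 0" for i
  proof
    assume "?s i = 0"
    from arg_cong[OF this, of "\<lambda>m. Poly_Mapping.lookup m i"] show False by simp
  qed
  then have nz: "0 \<notin> range ?s" by fastforce
  have "f = (\<Sum>m\<in>insert 0 (range ?s). Poly_Mapping.single m (Poly_Mapping.lookup f m))"
    by (subst mpoly_eq_sum_monomials[of f], rule sum.mono_neutral_left) (use keys in \<open>auto simp: in_keys_iff\<close>)
  also have "\<dots> = Poly_Mapping.single 0 (w0\<^sup>2) + (\<Sum>i\<in>UNIV. Poly_Mapping.single (?s i) ((w i)\<^sup>2))"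
    using nz inj by (simp add: sum.reindex w w0)
  also have "Poly_Mapping.single 0 (w0\<^sup>2) = (const w0)\<^sup>2"
    by (simp add: const_def power2_eq_square mult_single)
  also have "(\<Sum>i\<in>UNIV. Poly_Mapping.single (?s i) ((w i)\<^sup>2)) = (\<Sum>i\<in>UNIV. (Poly_Mapping.single (Poly_Mapping.single i 1) (w i))\<^sup>2)"
    by (rule sum.cong) (simp_all add: power2_eq_square mult_single flip: single_add)
  also have "(const w0)\<^sup>2 + \<dots> = (const w0 + (\<Sum>i\<in>UNIV. Poly_Mapping.single (Poly_Mapping.single i 1) (w i)))\<^sup>2"
    by (simp add: sum_squared_char_2[OF two] power2_sum two)
  finally show ?thesis by blast
qed

text \<open>
  Derivatives of the homogenized polynomial at the point at infinity in the direction of the \<open>i\<close>-th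
  axis: in the direction of \<open>z\<close>, and in that of another variable.
\<close>

lemma coeff_homogenize_vertical:
  fixes f :: "('n::finite, 'k::field) mpoly" and i :: 'n
  assumes "tdegree f \<le> 2"
  shows "poly.coeff (eval_mpoly (\<lambda>c. [:c:]) (case_option u (case_option [:0, 1:] (\<lambda>l. if l = i then 1 else 0))) (homogenize 2 f)) 1
    = Poly_Mapping.lookup f (Poly_Mapping.single i 1)"
proof -
  let ?x = "\<lambda>l. if l = i then 1 else 0 :: 'k poly"
  have "poly.coeff ([:Poly_Mapping.lookup f m:] * [:0, 1:] ^ (2 - mdeg m) * (\<Prod>l\<in>UNIV. ?x l ^ Poly_Mapping.lookup m l)) 1
      = (if m = Poly_Mapping.single i 1 then Poly_Mapping.lookup f m else 0)"
    if "m \<in> Poly_Mapping.keys f" for m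
  proof (cases "\<exists>l. l \<noteq> i \<and> Poly_Mapping.lookup m l \<noteq> 0")
    case True
    then have "(\<Prod>l\<in>UNIV. ?x l ^ Poly_Mapping.lookup m l) = 0" by (intro prod_zero) auto
    moreover have "m \<noteq> Poly_Mapping.single i 1" using True by (auto simp: lookup_single)
    ultimately show ?thesis by (simp only: mult_zero_right coeff_0 simp_thms if_False)
  next
    case False
    then have m: "m = Poly_Mapping.single i (Poly_Mapping.lookup m i)"
      by (intro poly_mapping_eqI) (auto simp: lookup_single when_def)
    have "(\<Prod>l\<in>UNIV. ?x l ^ Poly_Mapping.lookup m l) = 1" using False by (intro prod.neutral) auto
    moreover have d: "mdeg m = Poly_Mapping.lookup m i" by (subst m) (simp add: wdeg_single)
    moreover have "mdeg m \<le> 2" using mdeg_le_tdegree[OF that] assms by simp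
    moreover have "m = Poly_Mapping.single i 1 \<longleftrightarrow> Poly_Mapping.lookup m i = 1"
      using m by (metis lookup_single_eq)
    moreover have "poly.coeff ([:a:] * [:0, 1:] ^ (2 - e) * 1) 1 = (if e = 1 then a else 0)" if "e \<le> 2" for a :: 'k and e
    proof -
      have "[:a:] * [:0, 1:] ^ (2 - e) * 1 = Polynomial.monom a (2 - e)" by (simp add: monom_altdef)
      then show ?thesis using that by auto
    qed
    ultimately show ?thesis by (simp only:)
  qed
  then have "poly.coeff (eval_mpoly (\<lambda>c. [:c:]) (case_option u (case_option [:0, 1:] ?x)) (homogenize 2 f)) 1 =
      (\<Sum>m\<in>Poly_Mapping.keys f. if m = Poly_Mapping.single i 1 then Poly_Mapping.lookup f m else 0)"
    unfolding eval_homogenize[OF unital_hom_const_poly_id] coeff_sum by (intro sum.cong) (simp_all only: option.case)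
  then show ?thesis by (simp add: in_keys_iff)
qed

lemma coeff_homogenize_horizontal:
  fixes f :: "('n::finite, 'k::field) mpoly" and i l :: 'n
  assumes "tdegree f \<le> 2" "l \<noteq> i"
  shows "poly.coeff (eval_mpoly (\<lambda>c. [:c:]) (case_option u (case_option 0 (\<lambda>k. if k = i then 1 else if k = l then [:0, 1:] else 0))) (homogenize 2 f)) 1
    = Poly_Mapping.lookup f (Poly_Mapping.single i 1 + Poly_Mapping.single l 1)"
proof -
  let ?x = "\<lambda>k. if k = i then 1 else if k = l then [:0, 1:] else 0 :: 'k poly"
  let ?m0 = "Poly_Mapping.single i 1 + Poly_Mapping.single l (1::nat)"
  have deg: "mdeg ?m0 = 2" by (simp add: wdeg_add wdeg_single)
  have "poly.coeff ([:Poly_Mapping.lookup f m:] * 0 ^ (2 - mdeg m) * (\<Prod>k\<in>UNIV. ?x k ^ Poly_Mapping.lookup m k)) 1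
      = (if m = ?m0 then Poly_Mapping.lookup f m else 0)"
    if "m \<in> Poly_Mapping.keys f" for m
  proof (cases "mdeg m = 2")
    case False
    then have "mdeg m < 2" using mdeg_le_tdegree[OF that] assms(1) by simp
    moreover have "m \<noteq> ?m0" using False deg by auto
    ultimately show ?thesis by (simp add: power_0_left)
  next
    case d: True
    show ?thesis
    proof (cases "\<exists>k. k \<noteq> i \<and> k \<noteq> l \<and> Poly_Mapping.lookup m k \<noteq> 0")
      case True
      then have "(\<Prod>k\<in>UNIV. ?x k ^ Poly_Mapping.lookup m k) = 0" by (intro prod_zero) auto
      moreover have "m \<noteq> ?m0" using True by (auto simp: lookup_single lookup_add)
      ultimately show ?thesis by (simp only: mult_zero_right coeff_0 simp_thms if_False)
    next
      case False
      have "(\<Prod>k\<in>UNIV. ?x k ^ Poly_Mapping.lookup m k) = (\<Prod>k\<in>UNIV. if k = l then [:0, 1:] ^ Poly_Mapping.lookup m l else 1)"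
        by (rule prod.cong) (use False assms(2) in auto)
      then have p: "(\<Prod>k\<in>UNIV. ?x k ^ Poly_Mapping.lookup m k) = Polynomial.monom 1 (Poly_Mapping.lookup m l)"
        by (simp add: monom_altdef)
      have m: "m = Poly_Mapping.single i (Poly_Mapping.lookup m i) + Poly_Mapping.single l (Poly_Mapping.lookup m l)"
        by (rule poly_mapping_eqI) (use False assms(2) in \<open>auto simp: lookup_single lookup_add when_def\<close>)
      have "Poly_Mapping.lookup m i + Poly_Mapping.lookup m l = 2"
        using arg_cong[OF m, of mdeg] d by (simp add: wdeg_add wdeg_single)
      then have "Poly_Mapping.lookup m l = 1 \<longleftrightarrow> m = ?m0"
        using m assms(2) by (auto simp: lookup_add lookup_single One_nat_def)
      then show ?thesis by (simp add: p d)
    qed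
  qed
  then have "poly.coeff (eval_mpoly (\<lambda>c. [:c:]) (case_option u (case_option 0 ?x)) (homogenize 2 f)) 1 =
      (\<Sum>m\<in>Poly_Mapping.keys f. if m = ?m0 then Poly_Mapping.lookup f m else 0)"
    unfolding eval_homogenize[OF unital_hom_const_poly_id] coeff_sum by (intro sum.cong) (simp_all only: option.case)
  then show ?thesis by (simp add: in_keys_iff)
qed

lemma eval_homogenize_at_unit_vector:
  fixes f :: "('n::finite, 'k::field) mpoly" and i :: 'n
  assumes "tdegree f \<le> 2"
  shows "eval_mpoly id (case_option u (case_option 0 (\<lambda>l. if l = i then 1 else 0))) (homogenize 2 f)
    = Poly_Mapping.lookup f (Poly_Mapping.single i 2)"
proof -
  let ?x = "\<lambda>l. if l = i then 1 else 0 :: 'k"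
  have id: "unital_hom (id :: 'k \<Rightarrow> 'k)" by (simp add: unital_hom_def)
  have "id (Poly_Mapping.lookup f m) * 0 ^ (2 - mdeg m) * (\<Prod>l\<in>UNIV. ?x l ^ Poly_Mapping.lookup m l)
      = (if m = Poly_Mapping.single i 2 then Poly_Mapping.lookup f m else 0)"
    if "m \<in> Poly_Mapping.keys f" for m
  proof (cases "\<exists>l. l \<noteq> i \<and> Poly_Mapping.lookup m l \<noteq> 0")
    case True
    then have "(\<Prod>l\<in>UNIV. ?x l ^ Poly_Mapping.lookup m l) = 0" by (intro prod_zero) auto
    moreover have "m \<noteq> Poly_Mapping.single i 2" using True by (auto simp: lookup_single)
    ultimately show ?thesis by (simp only: mult_zero_right simp_thms if_False)
  next
    case False
    then have m: "m = Poly_Mapping.single i (Poly_Mapping.lookup m i)"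
      by (intro poly_mapping_eqI) (auto simp: lookup_single when_def)
    have "(\<Prod>l\<in>UNIV. ?x l ^ Poly_Mapping.lookup m l) = 1" using False by (intro prod.neutral) auto
    moreover have d: "mdeg m = Poly_Mapping.lookup m i" by (subst m) (simp add: wdeg_single)
    moreover have "mdeg m \<le> 2" using mdeg_le_tdegree[OF that] assms by simp
    moreover have "m = Poly_Mapping.single i 2 \<longleftrightarrow> Poly_Mapping.lookup m i = 2"
      using m by (metis lookup_single_eq)
    moreover have "id a * 0 ^ (2 - e) * 1 = (if e = 2 then a else 0)" if "e \<le> 2" for a :: 'k and e
      using that by (auto simp: power_0_left)
    ultimately show ?thesis by (simp only:)
  qed
  then have "eval_mpoly id (case_option u (case_option 0 ?x)) (homogenize 2 f) =
      (\<Sum>m\<in>Poly_Mapping.keys f. if m = Poly_Mapping.single i 2 then Poly_Mapping.lookup f m else 0)"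
    unfolding eval_homogenize[OF id] by (intro sum.cong) (simp_all only: option.case)
  then show ?thesis by (simp add: in_keys_iff)
qed

text \<open>
  The expansion of \<open>F\<close> along the line \<open>c + t \<eta>\<close> consists of the values at \<open>\<eta>\<close> of the components of the
  local equation.
\<close>

lemma coeff_eval_line:
  fixes F :: "('v::finite, 'k::field) mpoly"
  assumes "\<eta> i = 0"
  shows "poly.coeff (eval_mpoly (\<lambda>c. [:c:]) (\<lambda>l. [:c l, \<eta> l:]) F) e =
    eval_mpoly id \<eta> (hom_component (\<lambda>_. 1) e (local_equation F c i))"
proof -
  have "(\<lambda>l. [:c l, \<eta> l:]) = (\<lambda>l. [:c l:] + Polynomial.monom (\<eta> l) 1)"
    by (simp add: fun_eq_iff monom_altdef)
  then have "eval_mpoly (\<lambda>c. [:c:]) (\<lambda>l. [:c l, \<eta> l:]) F = graded_eval (\<lambda>_. 1) id \<eta> (local_equation F c i)"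
    unfolding graded_eval_def using assms
    by (subst eval_local_equation) (simp_all add: unital_hom_const_poly_id)
  then show ?thesis by (simp add: coeff_graded_eval)
qed

context quadratic_hypersurface
begin

text \<open>
  The candidates are the points \<open>(w, 0, e\<^sub>i)\<close> at infinity, where \<open>w\<^sup>2\<close> is the coefficient of
  \<open>X\<^sub>i\<^sup>2\<close>.  Such a point is smooth if one of the derivatives there is nonzero; these are \<open>2w\<close> and, up
  to sign, the coefficients of \<open>X\<^sub>i\<close> and of \<open>X\<^sub>i X\<^sub>l\<close> with \<open>l \<noteq> i\<close>.  If all of them vanish for all \<open>i\<close>,
  then \<open>f\<close> is diagonal, thus constant or a square.
\<close>

lemma rationalizable_if_degree_le_2:
  assumes j: "j = 0" and r: "r = 1" and f: "squarefree f" "\<forall>c. f \<noteq> const c"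
    and closed: "\<forall>h :: 'k poly. Polynomial.degree h > 0 \<longrightarrow> (\<exists>x. poly h x = 0)"
  shows "rationalizable (Fract f 1)"
proof -
  let ?C = "Poly_Mapping.lookup f" and ?e = "\<lambda>i :: 'n. Poly_Mapping.single i (1::nat)"
  have deg: "tdegree f \<le> 2" using tdegree_le j r by simp
  have "\<forall>a :: 'k. \<exists>w. w\<^sup>2 = a" using square_root_from_closedness[OF closed] by blast
  then obtain sq :: "'k \<Rightarrow> 'k" where sq: "\<And>a. (sq a)\<^sup>2 = a" by metis
  have "\<exists>i. 2 * sq (?C (Poly_Mapping.single i 2)) \<noteq> 0 \<or> ?C (?e i) \<noteq> 0 \<or> (\<exists>l. l \<noteq> i \<and> ?C (?e i + ?e l) \<noteq> 0)"
  proof (rule ccontr)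
    assume "\<not> ?thesis"
    then have 2: "2 * sq (?C (Poly_Mapping.single i 2)) = 0" and 1: "?C (?e i) = 0"
      and mixed: "l \<noteq> i \<Longrightarrow> ?C (?e i + ?e l) = 0" for i l by blast+
    have "Poly_Mapping.keys f \<subseteq> insert 0 (range (\<lambda>i. Poly_Mapping.single i 2))"
    proof
      fix m assume m: "m \<in> Poly_Mapping.keys f"
      then have "mdeg m \<le> 2" using mdeg_le_tdegree[OF m] deg by simp
      then consider "m = 0" | i where "m = ?e i" | i l where "m = ?e i + ?e l"
        using mdeg_le_2_cases by blast
      then show "m \<in> insert 0 (range (\<lambda>i. Poly_Mapping.single i 2))"
      proof cases
        case 3
        then have "l = i" using m mixed by (auto simp: in_keys_iff)
        then show ?thesis using 3 by (simp flip: single_add)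
      qed (use m 1 in \<open>auto simp: in_keys_iff\<close>)
    qed
    then have "(\<exists>c. f = const c) \<or> (\<exists>g. f = g\<^sup>2)"
      by (rule diagonal_quadratic_is_square[OF _ sq 2 sq])
    then obtain g where "g\<^sup>2 = f * 1\<^sup>2" using f(2) by auto
    then have "f dvd 1" by (rule squarefree_ratio_of_squares[OF f(1) one_neq_zero])
    then show False using is_unit_mpoly_imp_const f(2) by blast
  qed
  then obtain i where i: "2 * sq (?C (Poly_Mapping.single i 2)) \<noteq> 0 \<or> ?C (?e i) \<noteq> 0 \<or> (\<exists>l. l \<noteq> i \<and> ?C (?e i + ?e l) \<noteq> 0)"
    by blast
  define w where "w = sq (?C (Poly_Mapping.single i 2))"
  define c where "c = case_option w (case_option 0 (\<lambda>l. if l = i then 1 else 0))"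
  let ?I = "Some (Some i)" and ?L = "local_equation equation c (Some (Some i))"
  have id: "unital_hom (id :: 'k \<Rightarrow> 'k)" by (simp add: unital_hom_def)
  have eval2: "eval_mpoly h x equation = (x None)\<^sup>2 - eval_mpoly h x (homogenize 2 f)"
    if "unital_hom h" for h :: "'k \<Rightarrow> 'r::comm_ring_1" and x
  proof -
    have "j + 2 * r = 2" using j r by simp
    with j eval_equation[OF that, of x] show ?thesis by (simp only: power_0 mult_1)
  qed
  have "Poly_Mapping.lookup ?L 0 = eval_mpoly id (\<lambda>_. 0) (hom_component (\<lambda>_. 1) 0 ?L)"
  proof -
    have "hom_component (\<lambda>_. 1) 0 ?L = const (Poly_Mapping.lookup ?L 0)"
      by (rule poly_mapping_eqI) (simp add: lookup_hom_component const_def lookup_single when_def mdeg_eq_0_iff)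
    then show ?thesis by (simp add: eval_mpoly_const[OF id])
  qed
  also have "\<dots> = poly.coeff (eval_mpoly (\<lambda>c. [:c:]) (\<lambda>l. [:c l, 0:]) equation) 0"
    by (rule coeff_eval_line[symmetric]) simp
  also have "eval_mpoly (\<lambda>c. [:c:]) (\<lambda>l. [:c l, 0:]) equation = [:eval_mpoly id c equation:]"
    by (simp add: hom_eval_mpoly[OF unital_hom_const_poly_id])
  also have "eval_mpoly id c equation = 0"
    using eval_homogenize_at_unit_vector[OF deg, of w i]
    by (simp add: eval2[OF id] c_def) (simp add: w_def sq)
  finally have L0: "Poly_Mapping.lookup ?L 0 = 0" by simp
  show ?thesis
  proof (rule rationalizable_if_multiplicity[OF r f])
    show "c ?I \<noteq> 0" by (simp add: c_def)
    show "\<forall>m\<in>Poly_Mapping.keys ?L. j + 1 \<le> mdeg m"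
    proof
      fix m assume m: "m \<in> Poly_Mapping.keys ?L"
      have "mdeg m \<noteq> 0"
      proof
        assume "mdeg m = 0"
        then have "m = 0" by (simp only: mdeg_eq_0_iff)
        then show False using m L0 by (simp add: in_keys_iff)
      qed
      then show "j + 1 \<le> mdeg m" using j by simp
    qed
    show "\<exists>m\<in>Poly_Mapping.keys ?L. mdeg m = j + 1"
    proof (rule ccontr)
      assume no: "\<not> ?thesis"
      have "hom_component (\<lambda>_. 1) 1 ?L = 0"
        by (rule poly_mapping_eqI) (use no j in \<open>auto simp: lookup_hom_component in_keys_iff\<close>)
      then have line: "poly.coeff (eval_mpoly (\<lambda>c. [:c:]) (\<lambda>l. [:c l, \<eta> l:]) equation) 1 = 0" if "\<eta> ?I = 0" for \<eta>
        by (simp add: coeff_eval_line[where i = ?I and \<eta> = \<eta>, OF that] eval_mpoly_simps[OF id])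
      note eval2' = eval2[OF unital_hom_const_poly_id]
      \<comment> \<open>The three kinds of directions \<open>\<eta>\<close> that are tangent to the chart: along \<open>w\<close>, along \<open>z\<close>, and along \<open>x\<^sub>l\<close>.\<close>
      have "2 * w = 0"
      proof -
        let ?x = "\<lambda>l. [:c l, case_option 1 (\<lambda>_. 0) l:]"
        have "eval_mpoly (\<lambda>c. [:c:]) ?x (homogenize 2 f) = eval_mpoly (\<lambda>c. [:c:]) (\<lambda>l. [:c l:]) (homogenize 2 f)"
          unfolding eval_homogenize[OF unital_hom_const_poly_id] by simp
        also have "\<dots> = [:eval_mpoly id c (homogenize 2 f):]"
          by (simp add: hom_eval_mpoly[OF unital_hom_const_poly_id])
        finally have "eval_mpoly (\<lambda>c. [:c:]) ?x equation = [:w, 1:]\<^sup>2 - [:eval_mpoly id c (homogenize 2 f):]"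
          by (simp add: eval2' c_def)
        then show ?thesis using line[of "case_option 1 (\<lambda>_. 0)"]
          by (simp add: power2_eq_square One_nat_def)
      qed
      moreover have "?C (?e i) = 0"
      proof -
        let ?\<eta> = "case_option 0 (case_option 1 (\<lambda>_. 0))"
        have "(\<lambda>l. [:c l, ?\<eta> l:]) = case_option [:w:] (case_option [:0, 1:] (\<lambda>l. if l = i then 1 else 0))"
          by (auto simp: fun_eq_iff c_def one_pCons split: option.split)
        then have "poly.coeff ([:w:]\<^sup>2) 1 - ?C (?e i) = 0"
          using line[of ?\<eta>] coeff_homogenize_vertical[OF deg, of "[:w:]" i] by (simp add: eval2')
        then show ?thesis by (simp add: power2_eq_square One_nat_def)
      qed
      moreover have "?C (?e i + ?e l) = 0" if "l \<noteq> i" for l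
      proof -
        let ?\<eta> = "case_option 0 (case_option 0 (\<lambda>k. if k = l then 1 else 0))"
        have "(\<lambda>l. [:c l, ?\<eta> l:]) = case_option [:w:] (case_option 0 (\<lambda>k. if k = i then 1 else if k = l then [:0, 1:] else 0))"
          using that by (auto simp: fun_eq_iff c_def one_pCons split: option.split)
        then have "poly.coeff ([:w:]\<^sup>2) 1 - ?C (?e i + ?e l) = 0"
          using line[of ?\<eta>] coeff_homogenize_horizontal[OF deg that, of "[:w:]"] that by (simp add: eval2')
        then show ?thesis by (simp add: power2_eq_square One_nat_def)
      qed
      ultimately show False using i by (auto simp: w_def)
    qed
  qed
qed

end

section \<open>The two varieties associated to a square root\<close>

lemma tdegree_pos:
  fixes f :: "('n::finite, 'k::field) mpoly"
  assumes "\<forall>c. f \<noteq> const c" shows "tdegree f > 0"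
proof (rule ccontr)
  assume "\<not> ?thesis"
  then have 0: "mdeg m = 0" if "m \<in> Poly_Mapping.keys f" for m using mdeg_le_tdegree[OF that] by simp
  then have "Poly_Mapping.keys f \<subseteq> {0}" by (simp only: mdeg_eq_0_iff) blast
  then have "f = const (Poly_Mapping.lookup f 0)"
    by (intro poly_mapping_eqI) (auto simp: const_def lookup_single when_def in_keys_iff)
  then show False using assms by blast
qed

lemma quadratic_hypersurface_closure:
  fixes f :: "('n::{finite,linorder}, 'k::field) mpoly"
  assumes "tdegree f > 0"
  shows "quadratic_hypersurface f 1 (tdegree f - 2)"
    and "quadratic_hypersurface.equation f 1 (tdegree f - 2) = assoc_hypersurface_eq f"
    and "quadratic_hypersurface.wt 1 = (\<lambda>_ :: 'n option option. 1)"
proof -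
  show "quadratic_hypersurface f 1 (tdegree f - 2)" by unfold_locales auto
  then interpret quadratic_hypersurface f 1 "tdegree f - 2" .
  show "wt = (\<lambda>_. 1)" by (simp add: fun_eq_iff wt_def)
  show "equation = assoc_hypersurface_eq f"
  proof (cases "tdegree f = 1")
    case False
    then have "tdegree f - 2 + 2 * 1 = tdegree f" using assms by simp
    then show ?thesis unfolding equation_def assoc_hypersurface_eq_def using False by simp
  next
    case True
    then show ?thesis unfolding equation_def assoc_hypersurface_eq_def
      by (simp add: numeral_2_eq_2 One_nat_def)
  qed
qed

lemma quadratic_hypersurface_double_cover:
  fixes f :: "('n::{finite,linorder}, 'k::field) mpoly"
  assumes "tdegree f > 0"
  shows "quadratic_hypersurface f (half_degree f) 0"
    and "quadratic_hypersurface.equation f (half_degree f) 0 = (var None)\<^sup>2 - homogenize (2 * half_degree f) f"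
    and "quadratic_hypersurface.wt (half_degree f) = cover_weights f"
proof -
  have "real (tdegree f) / 2 \<le> real (half_degree f)"
    unfolding half_degree_def by (rule real_nat_ceiling_ge)
  then have "tdegree f \<le> 2 * half_degree f" by linarith
  then show "quadratic_hypersurface f (half_degree f) 0"
    using assms by unfold_locales auto
  then interpret quadratic_hypersurface f "half_degree f" 0 .
  show "wt = cover_weights f" by (simp add: fun_eq_iff wt_def cover_weights_def)
  show "equation = (var None)\<^sup>2 - homogenize (2 * half_degree f) f" by (simp add: equation_def)
qed

theorem theorem1:
  shows "(\<forall>(p :: ('n::{finite,linorder}, 'k::field) mpoly) (q :: ('n, 'k) mpoly). q \<noteq> 0 \<longrightarrow>
           (\<exists>f :: ('n, 'k) mpoly. squarefree f \<and>
              (rationalizable (Fract p q) \<longleftrightarrow> rationalizable (Fract f 1)))) \<and>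
         (\<forall>f :: ('n, 'k) mpoly. squarefree f \<and> (\<forall>c. f \<noteq> const c) \<longrightarrow>
           (rationalizable (Fract f 1) \<longleftrightarrow> unirational (\<lambda>_. 1) (assoc_hypersurface f)) \<and>
           (rationalizable (Fract f 1) \<longleftrightarrow>
              unirational (cover_weights f) (assoc_double_cover f))) \<and>
         ((\<forall>h :: 'k poly. Polynomial.degree h > 0 \<longrightarrow> (\<exists>x. poly h x = 0)) \<longrightarrow>
           (\<forall>f :: ('n, 'k) mpoly. squarefree f \<and> (\<forall>c. f \<noteq> const c) \<and>
              (tdegree f \<in> {1, 2} \<or>
               (\<exists>c. singular_point (assoc_hypersurface_eq f) c \<and>
                    has_point_multiplicity (assoc_hypersurface_eq f) c (tdegree f - 1))) \<longrightarrow>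
              rationalizable (Fract f 1)))"
proof (intro conjI allI impI)
  fix p q :: "('n, 'k) mpoly"
  assume "q \<noteq> 0"
  then show "\<exists>f :: ('n, 'k) mpoly. squarefree f \<and> (rationalizable (Fract p q) \<longleftrightarrow> rationalizable (Fract f 1))"
    by (rule rationalizable_Fract_iff_squarefree)
next
  fix f :: "('n, 'k) mpoly"
  assume f: "squarefree f \<and> (\<forall>c. f \<noteq> const c)"
  then have d: "tdegree f > 0" using tdegree_pos by blast
  interpret quadratic_hypersurface f 1 "tdegree f - 2" by (rule quadratic_hypersurface_closure(1)[OF d])
  show "rationalizable (Fract f 1) \<longleftrightarrow> unirational (\<lambda>_. 1) (assoc_hypersurface f)"
    using rationalizable_imp_unirational unirational_imp_rationalizable f
    unfolding quadratic_hypersurface_closure(2,3)[OF d] assoc_hypersurface_def by blast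
next
  fix f :: "('n, 'k) mpoly"
  assume f: "squarefree f \<and> (\<forall>c. f \<noteq> const c)"
  then have d: "tdegree f > 0" using tdegree_pos by blast
  interpret quadratic_hypersurface f "half_degree f" 0 by (rule quadratic_hypersurface_double_cover(1)[OF d])
  show "rationalizable (Fract f 1) \<longleftrightarrow> unirational (cover_weights f) (assoc_double_cover f)"
    using rationalizable_imp_unirational unirational_imp_rationalizable f
    unfolding quadratic_hypersurface_double_cover(2,3)[OF d] assoc_double_cover_def by blast
next
  fix f :: "('n, 'k) mpoly"
  assume closed: "\<forall>h :: 'k poly. Polynomial.degree h > 0 \<longrightarrow> (\<exists>x. poly h x = 0)"
    and f: "squarefree f \<and> (\<forall>c. f \<noteq> const c) \<and> (tdegree f \<in> {1, 2} \<or>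
      (\<exists>c. singular_point (assoc_hypersurface_eq f) c \<and>
        has_point_multiplicity (assoc_hypersurface_eq f) c (tdegree f - 1)))"
  then have d: "tdegree f > 0" using tdegree_pos by blast
  interpret quadratic_hypersurface f 1 "tdegree f - 2" by (rule quadratic_hypersurface_closure(1)[OF d])
  show "rationalizable (Fract f 1)"
  proof (cases "tdegree f \<le> 2")
    case True
    then show ?thesis using rationalizable_if_degree_le_2 f closed by simp
  next
    case False
    then obtain c where "has_point_multiplicity equation c (tdegree f - 1)"
      unfolding quadratic_hypersurface_closure(2)[OF d] using f by auto
    moreover have "tdegree f - 1 = tdegree f - 2 + 1" using False by simp
    ultimately obtain i where "c i \<noteq> 0"
      and "\<forall>m\<in>Poly_Mapping.keys (local_equation equation c i). tdegree f - 2 + 1 \<le> mdeg m"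
      and "\<exists>m\<in>Poly_Mapping.keys (local_equation equation c i). mdeg m = tdegree f - 2 + 1"
      unfolding has_point_multiplicity_def by auto
    then show ?thesis using rationalizable_if_multiplicity[of c i] f by blast
  qed
qed

end
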